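(* Let $k\ge1$ and let $(H,\psi)$ be a rainbow pre-coloring tuple with colors in $[k]$. For every $\varepsilon>0$ there exists $\delta>0$ such that if a graph system $\mathcal{G} = (G_1, \ldots, G_k)$ on $n$ vertices has at most $\delta n^{|V(H)|}$ rainbow copies of $(H, \psi)$, then one can delete at most $\varepsilon n^2$ edges in total from the graphs $G_1,\dots,G_k$ to make $\mathcal{G}$ rainbow $(H, \psi)$-free.
   Context: Multigraphs have no loops. For a multigraph $H$ and distinct $u,v$, $E_{uv}$ is the set of edges between $u$ and $v$. A rainbow pre-coloring of $H$ is an injective map $\psi:X\to[k]$ with $X\subseteq E(H)$; $(H,\psi)$ is a rainbow pre-coloring tuple. A graph system of order $k$ on $V$ is a tuple $(G_1,\dots,G_k)$ of simple graphs on the common vertex set $V$. A rainbow copy of $(H,\psi)$ in $\mathcal{G}$ is a multigraph $H'$ with $V(H')\subseteq V$ together with an injective map $\psi':E(H')\to[k]$ such that for some isomorphism $\phi:H\to H'$, $\psi'\circ\phi$ extends $\psi$, and $e\in E(G_{\psi'(e)})$ for every $e\in E(H')$. $\mathcal{G}$ is rainbow $(H,\psi)$-free if it has no rainbow copy of $(H,\psi)$. *)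

theory Defs
  imports Complex_Main
begin

definition pairs_of :: "'v set \<Rightarrow> 'v set set" where
  "pairs_of V = {{u, v} | u v. u \<in> V \<and> v \<in> V \<and> u \<noteq> v}"

record ('v, 'e) multigraph =
  verts :: "'v set"
  edges :: "'e set"
  ends :: "'e \<Rightarrow> 'v set"

text \<open>Multigraphs are finite; requiring each edge to have two distinct ends excludes loops.
  The values of \<^term>\<open>ends H\<close> outside \<^term>\<open>edges H\<close> carry no meaning.\<close>

definition is_multigraph :: "('v, 'e) multigraph \<Rightarrow> bool" where
  "is_multigraph H \<longleftrightarrow>
     finite (verts H) \<and> finite (edges H) \<and> (\<forall>e \<in> edges H. ends H e \<in> pairs_of (verts H))"

definition multigraph_iso ::
  "('v, 'e) multigraph \<Rightarrow> ('w, 'f) multigraph \<Rightarrow> ('v \<Rightarrow> 'w) \<Rightarrow> ('e \<Rightarrow> 'f) \<Rightarrow> bool" where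
  "multigraph_iso H H' f g \<longleftrightarrow>
     bij_betw f (verts H) (verts H') \<and> bij_betw g (edges H) (edges H') \<and>
     (\<forall>e \<in> edges H. ends H' (g e) = f ` ends H e)"

text \<open>A pre-coloring is a partial map; the set \<open>X\<close> of pre-colored edges is its domain.
  The color set \<open>[k]\<close> is \<^term>\<open>{1..k}\<close>.\<close>

definition rainbow_precoloring :: "nat \<Rightarrow> ('v, 'e) multigraph \<Rightarrow> ('e \<Rightarrow> nat option) \<Rightarrow> bool" where
  "rainbow_precoloring k H \<psi> \<longleftrightarrow>
     dom \<psi> \<subseteq> edges H \<and> ran \<psi> \<subseteq> {1..k} \<and> inj_on \<psi> (dom \<psi>)"

text \<open>\<open>G i\<close> is the edge set of the \<open>i\<close>-th graph, for \<open>i\<close> in \<^term>\<open>{1..k}\<close>.\<close>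

definition graph_system :: "nat \<Rightarrow> 'a set \<Rightarrow> (nat \<Rightarrow> 'a set set) \<Rightarrow> bool" where
  "graph_system k V G \<longleftrightarrow> finite V \<and> (\<forall>i \<in> {1..k}. G i \<subseteq> pairs_of V)"

text \<open>A copy has the same number of edges as \<open>H\<close>, so its edges can be labelled by
  elements of the edge type of \<open>H\<close>.\<close>

definition rainbow_copy ::
  "nat \<Rightarrow> ('v, 'e) multigraph \<Rightarrow> ('e \<Rightarrow> nat option) \<Rightarrow> 'a set \<Rightarrow> (nat \<Rightarrow> 'a set set) \<Rightarrow>
   ('a, 'e) multigraph \<Rightarrow> ('e \<Rightarrow> nat) \<Rightarrow> bool" where
  "rainbow_copy k H \<psi> V G H' \<psi>' \<longleftrightarrow>
     is_multigraph H' \<and> verts H' \<subseteq> V \<and>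
     inj_on \<psi>' (edges H') \<and> \<psi>' ` edges H' \<subseteq> {1..k} \<and>
     (\<exists>f g. multigraph_iso H H' f g \<and> (\<forall>e \<in> dom \<psi>. \<psi> e = Some (\<psi>' (g e)))) \<and>
     (\<forall>e \<in> edges H'. ends H' e \<in> G (\<psi>' e))"

text \<open>Edge labels of a copy are irrelevant: two copies are the same if they agree up to a
  relabelling of the edges that preserves ends and colors. As colors are injective on
  the edges, this holds iff the vertex sets and the sets of (ends, color) pairs coincide.\<close>

definition rainbow_copies ::
  "nat \<Rightarrow> ('v, 'e) multigraph \<Rightarrow> ('e \<Rightarrow> nat option) \<Rightarrow> 'a set \<Rightarrow> (nat \<Rightarrow> 'a set set) \<Rightarrow>
   ('a set \<times> ('a set \<times> nat) set) set" where
  "rainbow_copies k H \<psi> V G =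
     {(verts H', (\<lambda>e. (ends H' e, \<psi>' e)) ` edges H') | H' \<psi>'. rainbow_copy k H \<psi> V G H' \<psi>'}"

definition rainbow_free ::
  "nat \<Rightarrow> ('v, 'e) multigraph \<Rightarrow> ('e \<Rightarrow> nat option) \<Rightarrow> 'a set \<Rightarrow> (nat \<Rightarrow> 'a set set) \<Rightarrow> bool" where
  "rainbow_free k H \<psi> V G \<longleftrightarrow> \<not> (\<exists>H' \<psi>'. rainbow_copy k H \<psi> V G H' \<psi>')"

end

theory Submission
  imports Defs "HOL-Library.FuncSet" "HOL-Library.Indicator_Function" "HOL-Analysis.Convex"
begin

text \<open>Every rainbow copy comes from one of the finitely many injective colorings \<open>c\<close> of the
  edges of \<open>H\<close> extending \<open>\<psi>\<close>, so it suffices to treat each \<open>c\<close> separately and take the union of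
  the deleted sets. For fixed \<open>c\<close> every edge \<open>e\<close> has its own graph \<open>G (c e)\<close>; intersecting the
  graphs of parallel edges leaves a removal lemma in which every edge of a simple graph carries
  its own binary relation on \<open>V\<close>. This follows from Szemeredi regularity: take one vertex
  partition that is regular for all the relations, delete the pairs lying in irregular, sparse
  or small cells, and note that a surviving homomorphism would by the counting lemma create a
  positive proportion of all maps. Regularity of a pair of cells is measured by the cut
  discrepancy relative to the size of the pair, which makes the counting lemma a telescoping
  argument over the edges.\<close>

section \<open>Averages over cells\<close>

text \<open>Conditional expectation of \<open>f\<close> under the uniform measure on
  \<open>\<Omega>\<close>, where the fibres of the labelling \<open>c\<close> are the cells.\<close>

definition cell_avg :: "'w set \<Rightarrow> ('w \<Rightarrow> 'l) \<Rightarrow> ('w \<Rightarrow> real) \<Rightarrow> 'w \<Rightarrow> real" where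
  "cell_avg \<Omega> c f w = (\<Sum>w' \<in> {w' \<in> \<Omega>. c w' = c w}. f w') / real (card {w' \<in> \<Omega>. c w' = c w})"

lemma cell_avg_cong: "c w = c w' \<Longrightarrow> cell_avg \<Omega> c f w = cell_avg \<Omega> c f w'"
  by (simp add: cell_avg_def)

text \<open>On one cell \<open>h\<close> is a constant and factors out, and \<open>f\<close> and its
  average have the same sum there. This is the projection property of conditional
  expectation.\<close>

lemma sum_cell_avg_mult:
  assumes fin: "finite \<Omega>" and h: "\<And>w w'. w \<in> \<Omega> \<Longrightarrow> w' \<in> \<Omega> \<Longrightarrow> c w = c w' \<Longrightarrow> h w = h w'"
  shows "(\<Sum>w\<in>\<Omega>. cell_avg \<Omega> c f w * h w) = (\<Sum>w\<in>\<Omega>. f w * h w)"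
proof -
  have "(\<Sum>w\<in>{w\<in>\<Omega>. c w = l}. cell_avg \<Omega> c f w * h w) = (\<Sum>w\<in>{w\<in>\<Omega>. c w = l}. f w * h w)"
    if l: "l \<in> c ` \<Omega>" for l
  proof -
    obtain v where v: "v \<in> \<Omega>" "c v = l" using l by blast
    let ?Q = "{w\<in>\<Omega>. c w = l}"
    have "v \<in> ?Q" using v by simp
    then have pos: "card ?Q > 0" using fin by (auto simp: card_gt_0_iff)
    have "(\<Sum>w\<in>?Q. cell_avg \<Omega> c f w * h w) = (\<Sum>w\<in>?Q. cell_avg \<Omega> c f v * h v)"
    proof (rule sum.cong)
      fix w assume w: "w \<in> ?Q"
      then have "h w = h v" using h[of w v] v by auto
      moreover have "cell_avg \<Omega> c f w = cell_avg \<Omega> c f v"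
        using w v by (intro cell_avg_cong) auto
      ultimately show "cell_avg \<Omega> c f w * h w = cell_avg \<Omega> c f v * h v" by simp
    qed simp
    also have "\<dots> = (\<Sum>w\<in>?Q. f w) * h v"
      using pos v by (simp add: cell_avg_def)
    also have "\<dots> = (\<Sum>w\<in>?Q. f w * h v)" by (simp add: sum_distrib_right)
    also have "\<dots> = (\<Sum>w\<in>?Q. f w * h w)"
    proof (rule sum.cong)
      fix w assume w: "w \<in> ?Q"
      then have "h w = h v" using h[of w v] v by auto
      then show "f w * h v = f w * h w" by simp
    qed simp
    finally show ?thesis .
  qed
  then show ?thesis
    by (subst (1 2) sum.image_gen[OF fin, of _ c]) (rule sum.cong, auto)
qed

text \<open>Averages over a coarser partition are the orthogonal projection of the finer averages,
  so the squared norms add up.\<close>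

lemma energy_pythagoras:
  assumes fin: "finite \<Omega>"
    and ref: "\<And>w w'. w \<in> \<Omega> \<Longrightarrow> w' \<in> \<Omega> \<Longrightarrow> c' w = c' w' \<Longrightarrow> c w = c w'"
  shows "(\<Sum>w\<in>\<Omega>. (cell_avg \<Omega> c' f w)\<^sup>2) =
    (\<Sum>w\<in>\<Omega>. (cell_avg \<Omega> c f w)\<^sup>2) + (\<Sum>w\<in>\<Omega>. (cell_avg \<Omega> c' f w - cell_avg \<Omega> c f w)\<^sup>2)"
proof -
  let ?g = "cell_avg \<Omega> c f" and ?g' = "cell_avg \<Omega> c' f"
  \<comment> \<open>By \<open>ref\<close> the coarse average is constant on the fine cells, so it is
    an admissible test function for both partitions.\<close>
  have "(\<Sum>w\<in>\<Omega>. ?g' w * ?g w) = (\<Sum>w\<in>\<Omega>. f w * ?g w)"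
    by (rule sum_cell_avg_mult[OF fin]) (rule cell_avg_cong, rule ref)
  also have "\<dots> = (\<Sum>w\<in>\<Omega>. ?g w * ?g w)"
    by (rule sum_cell_avg_mult[OF fin, symmetric]) (rule cell_avg_cong)
  finally have "(\<Sum>w\<in>\<Omega>. ?g' w * ?g w) = (\<Sum>w\<in>\<Omega>. ?g w * ?g w)" .
  moreover have "(\<Sum>w\<in>\<Omega>. (?g' w - ?g w)\<^sup>2) =
      (\<Sum>w\<in>\<Omega>. (?g' w)\<^sup>2) - 2 * (\<Sum>w\<in>\<Omega>. ?g' w * ?g w) + (\<Sum>w\<in>\<Omega>. ?g w * ?g w)"
    by (simp add: power2_diff sum.distrib sum_subtractf sum_distrib_left power2_eq_square
        algebra_simps)
  ultimately show ?thesis by (simp add: power2_eq_square)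
qed

text \<open>In a bad cell \<open>f\<close> deviates from its average on a set \<open>S\<close> that
  is a union of fine cells. The fine averages see this deviation, and Cauchy-Schwarz turns it into a
  variance of at least \<open>\<eta>\<^sup>2\<close> per point of the cell; Pythagoras converts the
  variance into energy.\<close>

lemma energy_increment:
  assumes fin: "finite \<Omega>" and bad: "bad \<subseteq> \<Omega>" and eta: "\<eta> \<ge> 0"
    and ref: "\<And>w w'. w \<in> \<Omega> \<Longrightarrow> w' \<in> \<Omega> \<Longrightarrow> c' w = c' w' \<Longrightarrow> c w = c w'"
    and cell: "\<And>w w'. w \<in> bad \<Longrightarrow> w' \<in> \<Omega> \<Longrightarrow> c w' = c w \<Longrightarrow> w' \<in> bad"
    and wit: "\<And>w. w \<in> bad \<Longrightarrow> \<exists>S \<subseteq> {w' \<in> \<Omega>. c w' = c w}.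
        (\<forall>v\<in>\<Omega>. \<forall>v'\<in>\<Omega>. c' v = c' v' \<longrightarrow> v \<in> S \<longrightarrow> v' \<in> S) \<and>
        \<bar>(\<Sum>v\<in>S. f v) - cell_avg \<Omega> c f w * real (card S)\<bar> \<ge> \<eta> * real (card {w' \<in> \<Omega>. c w' = c w})"
  shows "(\<Sum>w\<in>\<Omega>. (cell_avg \<Omega> c' f w)\<^sup>2) \<ge>
    (\<Sum>w\<in>\<Omega>. (cell_avg \<Omega> c f w)\<^sup>2) + \<eta>\<^sup>2 * real (card bad)"
proof -
  let ?g = "cell_avg \<Omega> c f" and ?g' = "cell_avg \<Omega> c' f"
  let ?d = "\<lambda>w. (?g' w - ?g w)\<^sup>2"
  have finb: "finite bad" using bad fin by (rule finite_subset)
  have gain: "(\<Sum>w\<in>{w\<in>bad. c w = l}. ?d w) \<ge> (\<Sum>w\<in>{w\<in>bad. c w = l}. \<eta>\<^sup>2)" if l: "l \<in> c ` bad" for l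
  proof -
    obtain w where w: "w \<in> bad" "c w = l" using l by blast
    let ?Q = "{w' \<in> \<Omega>. c w' = c w}"
    have Q: "{w\<in>bad. c w = l} = ?Q" using cell[OF w(1)] w(2) bad by auto
    have finQ: "finite ?Q" using fin by simp
    have "w \<in> ?Q" using w bad by auto
    then have pos: "real (card ?Q) > 0" using finQ by (auto simp: card_gt_0_iff)
    obtain S where S: "S \<subseteq> ?Q"
      and meas: "\<And>v v'. v\<in>\<Omega> \<Longrightarrow> v'\<in>\<Omega> \<Longrightarrow> c' v = c' v' \<Longrightarrow> v \<in> S \<Longrightarrow> v' \<in> S"
      and dev: "\<bar>(\<Sum>v\<in>S. f v) - ?g w * real (card S)\<bar> \<ge> \<eta> * real (card ?Q)"
      using wit[OF w(1)] by blast
    have SO: "S \<subseteq> \<Omega>" using S by auto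
    have ind: "(\<Sum>v\<in>S. r v) = (\<Sum>v\<in>\<Omega>. r v * indicator S v)" for r :: "'a \<Rightarrow> real"
      using SO fin by (simp add: sum_mult_indicator Int_absorb1)
    \<comment> \<open>The indicator of \<open>S\<close> is constant on fine cells, so the fine
      averages have the same sum over \<open>S\<close> as \<open>f\<close>.\<close>
    have "(\<Sum>v\<in>S. ?g' v) = (\<Sum>v\<in>S. f v)"
      unfolding ind
      by (rule sum_cell_avg_mult[OF fin]) (use meas in \<open>metis indicator_simps\<close>)
    moreover have "(\<Sum>v\<in>S. ?g v) = ?g w * real (card S)"
    proof -
      have "(\<Sum>v\<in>S. ?g v) = (\<Sum>v\<in>S. ?g w)"
        by (rule sum.cong) (use S in \<open>auto intro: cell_avg_cong\<close>)
      then show ?thesis by simp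
    qed
    ultimately have "\<bar>\<Sum>v\<in>S. ?g' v - ?g v\<bar> \<ge> \<eta> * real (card ?Q)"
      using dev by (simp add: sum_subtractf)
    then have "(\<eta> * real (card ?Q))\<^sup>2 \<le> (\<Sum>v\<in>S. ?g' v - ?g v)\<^sup>2"
      using eta by (metis abs_ge_self abs_le_square_iff abs_of_nonneg mult_nonneg_nonneg of_nat_0_le_iff)
    \<comment> \<open>Cauchy-Schwarz on \<open>S\<close>, then enlargement to the whole cell; one
      factor \<open>card ?Q\<close> cancels afterwards.\<close>
    also have "\<dots> \<le> real (card S) * (\<Sum>v\<in>S. ?d v)" using sum_squared_le_sum_of_squares[of "\<lambda>v. ?g' v - ?g v" S] by (simp add: mult.commute)
    also have "\<dots> \<le> real (card ?Q) * (\<Sum>v\<in>?Q. ?d v)"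
      using S finQ by (intro mult_mono sum_mono2 sum_nonneg) (auto intro: card_mono)
    finally have "real (card ?Q) * (\<eta>\<^sup>2 * real (card ?Q)) \<le> real (card ?Q) * (\<Sum>v\<in>?Q. ?d v)"
      by (simp add: power2_eq_square algebra_simps)
    then have "\<eta>\<^sup>2 * real (card ?Q) \<le> (\<Sum>v\<in>?Q. ?d v)"
      using pos by (simp only: mult_le_cancel_left_pos)
    then show ?thesis unfolding Q by (simp add: mult.commute)
  qed
  have "\<eta>\<^sup>2 * real (card bad) = (\<Sum>w\<in>bad. \<eta>\<^sup>2)" by simp
  also have "\<dots> = (\<Sum>l\<in>c ` bad. \<Sum>w\<in>{w\<in>bad. c w = l}. \<eta>\<^sup>2)"
    by (rule sum.image_gen[OF finb])
  also have "\<dots> \<le> (\<Sum>l\<in>c ` bad. \<Sum>w\<in>{w\<in>bad. c w = l}. ?d w)"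
    by (rule sum_mono) (rule gain)
  also have "\<dots> = (\<Sum>w\<in>bad. ?d w)" by (rule sum.image_gen[OF finb, symmetric])
  also have "\<dots> \<le> (\<Sum>w\<in>\<Omega>. ?d w)" by (rule sum_mono2[OF fin bad]) simp
  finally have "\<eta>\<^sup>2 * real (card bad) \<le> (\<Sum>w\<in>\<Omega>. ?d w)" .
  moreover have "(\<Sum>w\<in>\<Omega>. (?g' w)\<^sup>2) = (\<Sum>w\<in>\<Omega>. (?g w)\<^sup>2) + (\<Sum>w\<in>\<Omega>. ?d w)"
    by (rule energy_pythagoras[OF fin]) (rule ref)
  ultimately show ?thesis by linarith
qed


section \<open>Regularity for several relations\<close>

text \<open>A vertex partition is encoded by a finite family \<open>\<A>\<close> of sets generating it, so that
  refining means enlarging \<open>\<A>\<close>.\<close>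

definition atom_of :: "'a set \<Rightarrow> 'a set set \<Rightarrow> 'a \<Rightarrow> 'a set" where
  "atom_of V \<A> x = {y \<in> V. \<forall>A\<in>\<A>. y \<in> A \<longleftrightarrow> x \<in> A}"

lemma atom_of_subset: "atom_of V \<A> x \<subseteq> V"
  by (auto simp: atom_of_def)

lemma finite_atom_of: "finite V \<Longrightarrow> finite (atom_of V \<A> x)"
  by (simp add: atom_of_def)

lemma atom_of_self: "x \<in> V \<Longrightarrow> x \<in> atom_of V \<A> x"
  by (simp add: atom_of_def)

lemma atom_of_eq_iff:
  assumes "x \<in> V" "y \<in> V"
  shows "atom_of V \<A> y = atom_of V \<A> x \<longleftrightarrow> y \<in> atom_of V \<A> x"
proof
  show "y \<in> atom_of V \<A> x" if "atom_of V \<A> y = atom_of V \<A> x"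
    using atom_of_self[OF assms(2), of \<A>] that by simp
  show "atom_of V \<A> y = atom_of V \<A> x" if "y \<in> atom_of V \<A> x"
    unfolding atom_of_def by (rule Collect_cong) (use that in \<open>simp add: atom_of_def\<close>)
qed

text \<open>An atom is determined by which members of \<open>\<A>\<close> contain its
  points.\<close>

lemma finite_atoms_card_atoms:
  assumes "finite \<A>"
  shows "finite (atom_of V \<A> ` V)" "card (atom_of V \<A> ` V) \<le> 2 ^ card \<A>"
proof -
  let ?h = "\<lambda>T. {y\<in>V. \<forall>A\<in>\<A>. y \<in> A \<longleftrightarrow> A \<in> T}"
  have sub: "atom_of V \<A> ` V \<subseteq> ?h ` Pow \<A>"
  proof
    fix X assume "X \<in> atom_of V \<A> ` V"
    then obtain x where "x \<in> V" "X = atom_of V \<A> x" by blast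
    then have "X = ?h {A\<in>\<A>. x \<in> A}" by (auto simp: atom_of_def)
    then show "X \<in> ?h ` Pow \<A>" by blast
  qed
  have fin: "finite (?h ` Pow \<A>)" using assms by simp
  show "finite (atom_of V \<A> ` V)" using sub fin by (rule finite_subset)
  have "card (atom_of V \<A> ` V) \<le> card (?h ` Pow \<A>)" using fin sub by (rule card_mono)
  also have "\<dots> \<le> card (Pow \<A>)" using assms by (intro card_image_le) simp
  finally show "card (atom_of V \<A> ` V) \<le> 2 ^ card \<A>" using assms by (simp add: card_Pow)
qed

section \<open>Densities, cut regularity and energy\<close>

definition edge_density :: "('a \<times> 'b) set \<Rightarrow> 'a set \<Rightarrow> 'b set \<Rightarrow> real" where
  "edge_density R X Y = real (card (R \<inter> X \<times> Y)) / (real (card X) * real (card Y))"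

text \<open>The error is measured against all of \<open>X\<close> and \<open>Y\<close>, so the bound
  makes sense for rectangles \<open>A \<times> B\<close> of every size. This is the form in which
  errors can be summed in the counting lemma.\<close>

definition cut_regular :: "real \<Rightarrow> ('a \<times> 'b) set \<Rightarrow> 'a set \<Rightarrow> 'b set \<Rightarrow> bool" where
  "cut_regular \<eta> R X Y \<longleftrightarrow> (\<forall>A\<subseteq>X. \<forall>B\<subseteq>Y.
     \<bar>real (card (R \<inter> A \<times> B)) - edge_density R X Y * (real (card A) * real (card B))\<bar>
       \<le> \<eta> * (real (card X) * real (card Y)))"

lemma edge_density_nonneg: "0 \<le> edge_density R X Y"
  by (simp add: edge_density_def)

lemma edge_density_le_1:
  assumes "finite X" "finite Y"
  shows "edge_density R X Y \<le> 1"
proof -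
  have "card (R \<inter> X \<times> Y) \<le> card (X \<times> Y)" using assms by (intro card_mono) auto
  then have "real (card (R \<inter> X \<times> Y)) \<le> real (card X) * real (card Y)"
    by (simp add: card_cartesian_product flip: of_nat_mult)
  then show ?thesis unfolding edge_density_def by (auto simp: divide_le_eq_1 zero_less_mult_iff)
qed

text \<open>The usual index of a partition times \<open>(card V)\<^sup>2\<close>: summing over
  vertex pairs weights each pair of atoms by its size.\<close>

definition energy :: "'a set \<Rightarrow> 'a set set \<Rightarrow> ('a \<times> 'a) set \<Rightarrow> real" where
  "energy V \<A> R = (\<Sum>(x, y)\<in>V \<times> V. (edge_density R (atom_of V \<A> x) (atom_of V \<A> y))\<^sup>2)"

definition irregular :: "'a set \<Rightarrow> 'a set set \<Rightarrow> real \<Rightarrow> ('a \<times> 'a) set \<Rightarrow> ('a \<times> 'a) set" where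
  "irregular V \<A> \<eta> R =
     {(x, y) \<in> V \<times> V. \<not> cut_regular \<eta> R (atom_of V \<A> x) (atom_of V \<A> y)}"

abbreviation atom_pair :: "'a set \<Rightarrow> 'a set set \<Rightarrow> 'a \<times> 'a \<Rightarrow> 'a set \<times> 'a set" where
  "atom_pair V \<A> \<equiv> map_prod (atom_of V \<A>) (atom_of V \<A>)"

lemma atom_pair_cell:
  assumes "x \<in> V" "y \<in> V"
  shows "{w \<in> V \<times> V. atom_pair V \<A> w = atom_pair V \<A> (x, y)} = atom_of V \<A> x \<times> atom_of V \<A> y"
proof -
  have "w \<in> V \<times> V \<and> atom_pair V \<A> w = atom_pair V \<A> (x, y) \<longleftrightarrow> w \<in> atom_of V \<A> x \<times> atom_of V \<A> y" for w
    using assms atom_of_subset[of V \<A> x] atom_of_subset[of V \<A> y]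
    by (cases w) (simp add: atom_of_eq_iff cong: conj_cong, blast)
  then show ?thesis by blast
qed

lemma sum_indicator_card:
  "finite S \<Longrightarrow> (\<Sum>v\<in>S. indicator R v) = real (card (R \<inter> S))"
  by (simp add: indicator_def sum.If_cases Int_commute)

text \<open>Density is the conditional expectation of the indicator of \<open>R\<close>, which makes
  the abstract energy lemmas applicable to relations.\<close>

lemma cell_avg_atom_pair:
  assumes "finite V" "x \<in> V" "y \<in> V"
  shows "cell_avg (V \<times> V) (atom_pair V \<A>) (indicator R) (x, y) =
    edge_density R (atom_of V \<A> x) (atom_of V \<A> y)"
  unfolding cell_avg_def atom_pair_cell[OF assms(2,3)]
  using assms(1) by (simp add: finite_atom_of sum_indicator_card edge_density_def card_cartesian_product)

lemma energy_eq_cell_avg: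
  "finite V \<Longrightarrow> energy V \<A> R =
    (\<Sum>w\<in>V \<times> V. (cell_avg (V \<times> V) (atom_pair V \<A>) (indicator R) w)\<^sup>2)"
  unfolding energy_def by (intro sum.cong) (auto simp: cell_avg_atom_pair)

lemma energy_le:
  assumes "finite V"
  shows "energy V \<A> R \<le> (real (card V))\<^sup>2"
proof -
  have "energy V \<A> R \<le> (\<Sum>w\<in>V \<times> V. 1)"
    unfolding energy_def using assms
    by (intro sum_mono) (auto simp: power_le_one edge_density_nonneg edge_density_le_1 finite_atom_of)
  then show ?thesis by (simp add: card_cartesian_product power2_eq_square)
qed

lemma energy_nonneg: "0 \<le> energy V \<A> R"
  unfolding energy_def by (intro sum_nonneg) auto

lemma atom_pair_refine:
  assumes "\<A> \<subseteq> \<B>" "w \<in> V \<times> V" "w' \<in> V \<times> V" "atom_pair V \<B> w = atom_pair V \<B> w'"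
  shows "atom_pair V \<A> w = atom_pair V \<A> w'"
proof -
  have *: "atom_of V \<A> x = atom_of V \<A> y" if "x \<in> V" "y \<in> V" "atom_of V \<B> x = atom_of V \<B> y" for x y
  proof -
    have "x \<in> atom_of V \<B> y" using that atom_of_self by metis
    then have "x \<in> atom_of V \<A> y" using assms(1) by (auto simp: atom_of_def)
    then show ?thesis using that by (simp add: atom_of_eq_iff)
  qed
  obtain x y x' y' where "w = (x, y)" "w' = (x', y')" by (cases w, cases w')
  then show ?thesis using assms(2-4) *[of x x'] *[of y y'] by simp
qed

lemma energy_mono:
  assumes "finite V" "\<A> \<subseteq> \<B>"
  shows "energy V \<A> R \<le> energy V \<B> R"
proof -
  let ?f = "indicator R :: _ \<Rightarrow> real"
  have "0 \<le> (\<Sum>w\<in>V \<times> V. (cell_avg (V \<times> V) (atom_pair V \<B>) ?f w -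
      cell_avg (V \<times> V) (atom_pair V \<A>) ?f w)\<^sup>2)"
    by (intro sum_nonneg) auto
  moreover have "energy V \<B> R = energy V \<A> R + (\<Sum>w\<in>V \<times> V. (cell_avg (V \<times> V) (atom_pair V \<B>) ?f w -
      cell_avg (V \<times> V) (atom_pair V \<A>) ?f w)\<^sup>2)"
    unfolding energy_eq_cell_avg[OF assms(1)]
    by (rule energy_pythagoras) (use assms(1) in simp, rule atom_pair_refine[OF assms(2)])
  ultimately show ?thesis by linarith
qed

section \<open>Energy increment and its iteration\<close>

text \<open>Both sides of one violating rectangle per irregular pair of atoms are added to the
  generators: two sets for each of at most \<open>(2 ^ card \<A>)\<^sup>2\<close> pairs. Each
  rectangle is then a union of new cells, so the energy increment applies with the irregular pairs
  as bad set.\<close>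

lemma regularity_step:
  assumes V: "finite V" and A: "finite \<A>" and eta: "\<eta> > 0"
    and irr: "real (card (irregular V \<A> \<eta> R)) > \<eta> * (real (card V))\<^sup>2"
  shows "\<exists>\<B>. \<A> \<subseteq> \<B> \<and> finite \<B> \<and> card \<B> \<le> card \<A> + 2 * (2 ^ card \<A>)\<^sup>2 \<and>
    energy V \<B> R \<ge> energy V \<A> R + \<eta> ^ 3 * (real (card V))\<^sup>2"
proof -
  define dev where "dev X Y A B \<longleftrightarrow> A \<subseteq> X \<and> B \<subseteq> Y \<and>
     \<bar>real (card (R \<inter> A \<times> B)) - edge_density R X Y * (real (card A) * real (card B))\<bar>
       > \<eta> * (real (card X) * real (card Y))" for X Y A B
  \<comment> \<open>The implication makes the choice of \<open>W\<close> total; on regular pairs its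
    value is arbitrary.\<close>
  have "\<exists>W. \<not> cut_regular \<eta> R X Y \<longrightarrow> dev X Y (fst W) (snd W)" for X Y
    unfolding cut_regular_def dev_def fst_conv snd_conv by (auto simp: not_le)
  then obtain W where W: "\<And>X Y. \<not> cut_regular \<eta> R X Y \<Longrightarrow> dev X Y (fst (W X Y)) (snd (W X Y))"
    by metis
  let ?at = "atom_of V \<A> ` V"
  let ?N = "(\<lambda>(X, Y). fst (W X Y)) ` (?at \<times> ?at) \<union> (\<lambda>(X, Y). snd (W X Y)) ` (?at \<times> ?at)"
  define \<B> where "\<B> = \<A> \<union> ?N"
  note at = finite_atoms_card_atoms[OF A, of V]
  have fN: "finite ?N" using at(1) by simp
  have fp: "finite (?at \<times> ?at)" using at(1) by simp
  have "card ?N \<le> card (?at \<times> ?at) + card (?at \<times> ?at)"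
    by (rule order_trans[OF card_Un_le]) (intro add_mono card_image_le fp)
  also have "\<dots> \<le> 2 * (2 ^ card \<A>)\<^sup>2"
    using mult_mono[OF at(2) at(2)] by (simp add: card_cartesian_product power2_eq_square)
  finally have cN: "card ?N \<le> 2 * (2 ^ card \<A>)\<^sup>2" .
  have cB: "card \<B> \<le> card \<A> + 2 * (2 ^ card \<A>)\<^sup>2"
    unfolding \<B>_def using card_Un_le[of \<A> ?N] cN by linarith
  have AB: "\<A> \<subseteq> \<B>" by (auto simp: \<B>_def)
  have finB: "finite \<B>" unfolding \<B>_def using A fN by simp
  let ?bad = "irregular V \<A> \<eta> R"
  have fV: "finite (V \<times> V)" using V by simp
  have "energy V \<B> R \<ge> energy V \<A> R + \<eta>\<^sup>2 * real (card ?bad)"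
    unfolding energy_eq_cell_avg[OF V]
  proof (rule energy_increment[OF fV])
    show "?bad \<subseteq> V \<times> V" by (auto simp: irregular_def)
    show "0 \<le> \<eta>" using eta by simp
    show "\<And>w w'. w \<in> V \<times> V \<Longrightarrow> w' \<in> V \<times> V \<Longrightarrow> atom_pair V \<B> w = atom_pair V \<B> w' \<Longrightarrow>
        atom_pair V \<A> w = atom_pair V \<A> w'"
      by (rule atom_pair_refine[OF AB])
    show "\<And>w w'. w \<in> ?bad \<Longrightarrow> w' \<in> V \<times> V \<Longrightarrow> atom_pair V \<A> w' = atom_pair V \<A> w \<Longrightarrow> w' \<in> ?bad"
      by (auto simp: irregular_def)
  next
    fix w assume wb: "w \<in> ?bad"
    obtain x y where w: "w = (x, y)" by (cases w)
    have xy: "x \<in> V" "y \<in> V" and nr: "\<not> cut_regular \<eta> R (atom_of V \<A> x) (atom_of V \<A> y)"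
      using wb w by (auto simp: irregular_def)
    let ?X = "atom_of V \<A> x" and ?Y = "atom_of V \<A> y"
    let ?A = "fst (W ?X ?Y)" and ?B = "snd (W ?X ?Y)"
    have d: "dev ?X ?Y ?A ?B" by (rule W[OF nr])
    have AinB: "?A \<in> \<B>" "?B \<in> \<B>" unfolding \<B>_def using xy by (auto intro!: image_eqI[where x = "(?X, ?Y)"])
    have meas: "z \<in> D \<Longrightarrow> z' \<in> D" if "D \<in> \<B>" "z \<in> V" "z' \<in> V" "atom_of V \<B> z = atom_of V \<B> z'" for D z z'
      using that atom_of_self[of z V \<B>] by (auto simp: atom_of_def)
    have sub: "?A \<times> ?B \<subseteq> ?X \<times> ?Y" using d by (auto simp: dev_def)
    have finAB: "finite (?A \<times> ?B)"
      using sub V by (meson finite_SigmaI finite_atom_of finite_subset)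
    have sumf: "(\<Sum>v\<in>?A \<times> ?B. indicator R v) = real (card (R \<inter> ?A \<times> ?B))"
      by (rule sum_indicator_card[OF finAB])
    show "\<exists>S \<subseteq> {w' \<in> V \<times> V. atom_pair V \<A> w' = atom_pair V \<A> w}.
        (\<forall>v\<in>V \<times> V. \<forall>v'\<in>V \<times> V. atom_pair V \<B> v = atom_pair V \<B> v' \<longrightarrow> v \<in> S \<longrightarrow> v' \<in> S) \<and>
        \<bar>(\<Sum>v\<in>S. indicator R v) - cell_avg (V \<times> V) (atom_pair V \<A>) (indicator R) w * real (card S)\<bar>
          \<ge> \<eta> * real (card {w' \<in> V \<times> V. atom_pair V \<A> w' = atom_pair V \<A> w})"
      unfolding w atom_pair_cell[OF xy] cell_avg_atom_pair[OF V xy]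
    proof (intro exI[of _ "?A \<times> ?B"] conjI ballI impI)
      show "?A \<times> ?B \<subseteq> ?X \<times> ?Y" by (rule sub)
      fix v v' assume v: "v \<in> V \<times> V" "v' \<in> V \<times> V" "atom_pair V \<B> v = atom_pair V \<B> v'" "v \<in> ?A \<times> ?B"
      obtain a b a' b' where "v = (a, b)" "v' = (a', b')" by (cases v, cases v')
      then show "v' \<in> ?A \<times> ?B"
        using v meas[OF AinB(1), of a a'] meas[OF AinB(2), of b b'] by auto
    next
      show "\<bar>(\<Sum>v\<in>?A \<times> ?B. indicator R v) - edge_density R ?X ?Y * real (card (?A \<times> ?B))\<bar>
          \<ge> \<eta> * real (card (?X \<times> ?Y))"
        using d unfolding sumf dev_def card_cartesian_product of_nat_mult by linarith
    qed
  qed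
  \<comment> \<open>Two factors \<open>\<eta>\<close> come from the size of the deviation, the third
    from the proportion of irregular pairs.\<close>
  moreover have "\<eta>\<^sup>2 * real (card ?bad) \<ge> \<eta>\<^sup>2 * (\<eta> * (real (card V))\<^sup>2)"
    using irr by (intro mult_left_mono) auto
  ultimately have "energy V \<B> R \<ge> energy V \<A> R + \<eta> ^ 3 * (real (card V))\<^sup>2"
    by (simp add: power3_eq_cube power2_eq_square mult.assoc)
  then show ?thesis using AB finB cB by blast
qed

text \<open>Bounds the number of generating sets after \<open>j\<close> refinements, one
  \<open>regularity_step\<close> each; the number of atoms can be exponential in it.\<close>

primrec regularity_bound :: "nat \<Rightarrow> nat" where
  "regularity_bound 0 = 0"
| "regularity_bound (Suc j) = regularity_bound j + 2 * (2 ^ regularity_bound j)\<^sup>2"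

text \<open>Each round refines for one relation that still fails. Refinement never lowers the energy
  of the other relations, so the total energy grows by a fixed amount per round and a single
  partition serves all of \<open>E\<close>.\<close>

lemma regularity_iterate:
  assumes V: "finite V" and E: "finite E" and eta: "\<eta> > 0"
  shows "\<exists>\<A>. finite \<A> \<and> card \<A> \<le> regularity_bound j \<and>
    ((\<forall>e\<in>E. real (card (irregular V \<A> \<eta> (R e))) \<le> \<eta> * (real (card V))\<^sup>2) \<or>
     (\<Sum>e\<in>E. energy V \<A> (R e)) \<ge> real j * (\<eta> ^ 3 * (real (card V))\<^sup>2))"
proof (induction j)
  case 0
  show ?case by (intro exI[of _ "{}"]) (simp add: sum_nonneg energy_nonneg)
next
  case (Suc j)
  let ?b = "regularity_bound"
  obtain \<A> where A: "finite \<A>" "card \<A> \<le> ?b j"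
    and alt: "(\<forall>e\<in>E. real (card (irregular V \<A> \<eta> (R e))) \<le> \<eta> * (real (card V))\<^sup>2) \<or>
     (\<Sum>e\<in>E. energy V \<A> (R e)) \<ge> real j * (\<eta> ^ 3 * (real (card V))\<^sup>2)"
    using Suc by blast
  show ?case
  proof (cases "\<forall>e\<in>E. real (card (irregular V \<A> \<eta> (R e))) \<le> \<eta> * (real (card V))\<^sup>2")
    case True
    have "card \<A> \<le> ?b (Suc j)" using A(2) by simp
    with True A(1) show ?thesis by blast
  next
    case False
    then obtain e where e: "e \<in> E" "real (card (irregular V \<A> \<eta> (R e))) > \<eta> * (real (card V))\<^sup>2"
      by (auto simp: not_le)
    obtain \<B> where B: "\<A> \<subseteq> \<B>" "finite \<B>" "card \<B> \<le> card \<A> + 2 * (2 ^ card \<A>)\<^sup>2"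
      "energy V \<B> (R e) \<ge> energy V \<A> (R e) + \<eta> ^ 3 * (real (card V))\<^sup>2"
      using regularity_step[OF V A(1) eta e(2)] by blast
    have "card \<A> + 2 * (2 ^ card \<A>)\<^sup>2 \<le> ?b (Suc j)"
      using A(2) by (auto intro!: add_mono power_mono power_increasing)
    then have "card \<B> \<le> ?b (Suc j)" using B(3) by linarith
    moreover have "(\<Sum>e\<in>E. energy V \<B> (R e)) \<ge> real (Suc j) * (\<eta> ^ 3 * (real (card V))\<^sup>2)"
    proof -
      have "(\<Sum>e\<in>E - {e}. energy V \<A> (R e)) \<le> (\<Sum>e\<in>E - {e}. energy V \<B> (R e))"
        by (intro sum_mono energy_mono V B)
      then have "(\<Sum>e\<in>E. energy V \<B> (R e)) \<ge> (\<Sum>e\<in>E. energy V \<A> (R e)) + \<eta> ^ 3 * (real (card V))\<^sup>2"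
        using B(4) by (simp add: sum.remove[OF E e(1)])
      then show ?thesis using alt False by (simp add: algebra_simps)
    qed
    ultimately show ?thesis using B(2) by blast
  qed
qed

text \<open>The total energy is at most \<open>card E * (card V)\<^sup>2\<close>, so once
  \<open>j * \<eta> ^ 3\<close> exceeds \<open>card E\<close> the energy alternative of the
  iteration is impossible. This \<open>j\<close>, and with it the bound, is chosen before
  \<open>V\<close> and \<open>R\<close>.\<close>

lemma regularity:
  fixes \<eta> :: real
  assumes E: "finite E" and eta: "\<eta> > 0"
  shows "\<exists>M. \<forall>(V :: 'a set) R. finite V \<longrightarrow> (\<exists>\<A>. finite \<A> \<and> card \<A> \<le> M \<and>
    (\<forall>e\<in>E. real (card (irregular V \<A> \<eta> (R e))) \<le> \<eta> * (real (card V))\<^sup>2))"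
proof -
  obtain j :: nat where j: "real j * \<eta> ^ 3 > real (card E)"
    using ex_less_of_nat_mult[of "\<eta> ^ 3" "real (card E)"] eta by auto
  have "\<exists>\<A>. finite \<A> \<and> card \<A> \<le> regularity_bound j \<and>
    (\<forall>e\<in>E. real (card (irregular V \<A> \<eta> (R e))) \<le> \<eta> * (real (card V))\<^sup>2)"
    if V: "finite V" for V :: "'a set" and R
  proof (cases "V = {}")
    case True
    then show ?thesis by (intro exI[of _ "{}"]) (simp add: irregular_def)
  next
    case False
    then have pos: "(real (card V))\<^sup>2 > 0" using V by (simp add: card_gt_0_iff)
    have "(\<Sum>e\<in>E. energy V \<A> (R e)) < real j * (\<eta> ^ 3 * (real (card V))\<^sup>2)" for \<A>
    proof -
      have "(\<Sum>e\<in>E. energy V \<A> (R e)) \<le> (\<Sum>e\<in>E. (real (card V))\<^sup>2)"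
        by (intro sum_mono energy_le V)
      also have "\<dots> < real j * \<eta> ^ 3 * (real (card V))\<^sup>2"
        using j pos by simp
      finally show ?thesis by (simp add: mult.assoc)
    qed
    then show ?thesis using regularity_iterate[OF V E eta, of j R] by (meson not_le)
  qed
  then show ?thesis by blast
qed

section \<open>Counting and removal\<close>

text \<open>Fubini for maps: fix the values \<open>g\<close> outside \<open>a\<close> and
  \<open>b\<close>, then count the pairs of values at \<open>a\<close> and \<open>b\<close>.\<close>

lemma card_PiE_split2:
  assumes U: "finite U" "a \<in> U" "b \<in> U" "a \<noteq> b" and X: "\<And>u. u \<in> U \<Longrightarrow> finite (X u)"
  shows "card {f \<in> Pi\<^sub>E U X. \<Phi> f} =
    (\<Sum>g\<in>Pi\<^sub>E (U - {a, b}) X. card {(x, y) \<in> X a \<times> X b. \<Phi> (g(a := x, b := y))})"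
proof -
  let ?W = "U - {a, b}"
  let ?S = "Sigma (Pi\<^sub>E ?W X) (\<lambda>g. {(x, y) \<in> X a \<times> X b. \<Phi> (g(a := x, b := y))})"
  let ?F = "\<lambda>(g, (x, y)). g(a := x, b := y)"
  have upd: "(restrict f ?W)(a := f a, b := f b) = f" if "f \<in> Pi\<^sub>E U X" for f
  proof (rule ext)
    fix u
    show "((restrict f ?W)(a := f a, b := f b)) u = f u"
      using PiE_arb[OF that, of u] by auto
  qed
  have res: "restrict (g(a := x, b := y)) ?W = g" if "g \<in> Pi\<^sub>E ?W X" for g x y
  proof (rule ext)
    fix u
    show "restrict (g(a := x, b := y)) ?W u = g u"
      using PiE_arb[OF that, of u] by auto
  qed
  have "bij_betw ?F ?S {f \<in> Pi\<^sub>E U X. \<Phi> f}"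
  proof (rule bij_betw_byWitness[where f' = "\<lambda>f. (restrict f ?W, (f a, f b))"])
    show "\<forall>z\<in>?S. (restrict (?F z) ?W, (?F z a, ?F z b)) = z"
      using U(4) res by auto
    show "\<forall>f\<in>{f \<in> Pi\<^sub>E U X. \<Phi> f}. ?F (restrict f ?W, (f a, f b)) = f"
      using upd by auto
    show "?F ` ?S \<subseteq> {f \<in> Pi\<^sub>E U X. \<Phi> f}"
    proof (rule image_subsetI)
      fix z assume "z \<in> ?S"
      then obtain g x y where z: "z = (g, (x, y))" "g \<in> Pi\<^sub>E ?W X" "x \<in> X a" "y \<in> X b"
        "\<Phi> (g(a := x, b := y))" by auto
      have "g(a := x, b := y) \<in> Pi\<^sub>E (insert b (insert a ?W)) X"
        using z by (intro PiE_fun_upd)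
      moreover have "insert b (insert a ?W) = U" using U by auto
      ultimately show "?F z \<in> {f \<in> Pi\<^sub>E U X. \<Phi> f}" using z by simp
    qed
    show "(\<lambda>f. (restrict f ?W, (f a, f b))) ` {f \<in> Pi\<^sub>E U X. \<Phi> f} \<subseteq> ?S"
    proof (rule image_subsetI)
      fix f assume "f \<in> {f \<in> Pi\<^sub>E U X. \<Phi> f}"
      then have f: "f \<in> Pi\<^sub>E U X" "\<Phi> f" by auto
      then have "restrict f ?W \<in> Pi\<^sub>E ?W X" "f a \<in> X a" "f b \<in> X b"
        using U by auto
      then show "(restrict f ?W, (f a, f b)) \<in> ?S"
        using f(2) upd[OF f(1)] by simp
    qed
  qed
  then have "card {f \<in> Pi\<^sub>E U X. \<Phi> f} = card ?S" by (rule bij_betw_same_card[symmetric])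
  also have "\<dots> = (\<Sum>g\<in>Pi\<^sub>E ?W X. card {(x, y) \<in> X a \<times> X b. \<Phi> (g(a := x, b := y))})"
  proof (rule card_SigmaI)
    show "finite (Pi\<^sub>E ?W X)" using U(1) X by (intro finite_PiE) auto
    have "finite (X a \<times> X b)" using X U by simp
    then show "\<forall>g\<in>Pi\<^sub>E ?W X. finite {(x, y) \<in> X a \<times> X b. \<Phi> (g(a := x, b := y))}"
      by (auto intro: rev_finite_subset)
  qed
  finally show ?thesis .
qed

text \<open>With all vertices except \<open>a\<close> and \<open>b\<close> fixed, \<open>QA\<close> and \<open>QB\<close> cut out a rectangle of \<open>X a \<times> X b\<close>,
  to which cut regularity applies.\<close>

lemma counting_one_edge:
  fixes X :: "'u \<Rightarrow> 'a set"
  assumes U: "finite U" "a \<in> U" "b \<in> U" "a \<noteq> b" and X: "\<And>u. u \<in> U \<Longrightarrow> finite (X u)"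
    and reg: "cut_regular \<eta> R (X a) (X b)"
    and QA: "\<And>f y. QA (f(b := y)) = QA f" and QB: "\<And>f x. QB (f(a := x)) = QB f"
  shows "\<bar>real (card {f \<in> Pi\<^sub>E U X. (QA f \<and> QB f) \<and> (f a, f b) \<in> R}) -
      edge_density R (X a) (X b) * real (card {f \<in> Pi\<^sub>E U X. QA f \<and> QB f})\<bar>
    \<le> \<eta> * (\<Prod>u\<in>U. real (card (X u)))"
proof -
  let ?W = "U - {a, b}" and ?d = "edge_density R (X a) (X b)"
  define A where "A g = {x \<in> X a. QA (g(a := x))}" for g
  define B where "B g = {y \<in> X b. QB (g(b := y))}" for g
  have q: "QA (g(a := x, b := y)) = QA (g(a := x))" "QB (g(a := x, b := y)) = QB (g(b := y))" for g x y
    using QA[of "g(a := x)" y] QB[of "g(b := y)" x] U(4) by (simp_all add: fun_upd_twist)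
  have 1: "{(x, y) \<in> X a \<times> X b. (QA (g(a := x, b := y)) \<and> QB (g(a := x, b := y))) \<and>
      ((g(a := x, b := y)) a, (g(a := x, b := y)) b) \<in> R} = R \<inter> A g \<times> B g" for g
    using U(4) unfolding q A_def B_def by auto
  have 2: "{(x, y) \<in> X a \<times> X b. QA (g(a := x, b := y)) \<and> QB (g(a := x, b := y))} = A g \<times> B g" for g
    unfolding q A_def B_def by auto
  have c1: "real (card {f \<in> Pi\<^sub>E U X. (QA f \<and> QB f) \<and> (f a, f b) \<in> R}) =
      (\<Sum>g\<in>Pi\<^sub>E ?W X. real (card (R \<inter> A g \<times> B g)))"
    by (subst card_PiE_split2[OF U X]) (simp_all only: 1 of_nat_sum)
  have c2: "real (card {f \<in> Pi\<^sub>E U X. QA f \<and> QB f}) =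
      (\<Sum>g\<in>Pi\<^sub>E ?W X. real (card (A g)) * real (card (B g)))"
    by (subst card_PiE_split2[OF U X]) (simp_all only: 2 of_nat_sum card_cartesian_product of_nat_mult)
  have bd: "\<bar>real (card (R \<inter> A g \<times> B g)) - ?d * (real (card (A g)) * real (card (B g)))\<bar>
      \<le> \<eta> * (real (card (X a)) * real (card (X b)))" for g
  proof -
    have "A g \<subseteq> X a" "B g \<subseteq> X b" by (auto simp: A_def B_def)
    with reg[unfolded cut_regular_def] show ?thesis by simp
  qed
  have "\<bar>real (card {f \<in> Pi\<^sub>E U X. (QA f \<and> QB f) \<and> (f a, f b) \<in> R}) -
      ?d * real (card {f \<in> Pi\<^sub>E U X. QA f \<and> QB f})\<bar> =
      \<bar>\<Sum>g\<in>Pi\<^sub>E ?W X. real (card (R \<inter> A g \<times> B g)) - ?d * (real (card (A g)) * real (card (B g)))\<bar>"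
    unfolding c1 c2 sum_distrib_left sum_subtractf ..
  also have "\<dots> \<le> (\<Sum>g\<in>Pi\<^sub>E ?W X. \<bar>real (card (R \<inter> A g \<times> B g)) -
      ?d * (real (card (A g)) * real (card (B g)))\<bar>)"
    by (rule sum_abs)
  also have "\<dots> \<le> (\<Sum>g\<in>Pi\<^sub>E ?W X. \<eta> * (real (card (X a)) * real (card (X b))))"
    by (rule sum_mono) (rule bd)
  also have "\<dots> = \<eta> * (real (card (X a)) * real (card (X b)) * (\<Prod>u\<in>?W. real (card (X u))))"
    using U(1) by (simp add: card_PiE)
  also have "real (card (X a)) * real (card (X b)) * (\<Prod>u\<in>?W. real (card (X u))) = (\<Prod>u\<in>U. real (card (X u)))"
  proof -
    have "U - {a} - {b} = ?W" by auto
    then show ?thesis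
      using prod.remove[OF U(1,2), of "\<lambda>u. real (card (X u))"]
        prod.remove[of "U - {a}" b "\<lambda>u. real (card (X u))"] U by simp
  qed
  finally show ?thesis .
qed

text \<open>Imposing one more edge multiplies the count by its density up to an error
  \<open>\<eta>\<close> times the number of all maps. Densities are at most 1, so earlier errors do
  not grow and the errors add up.\<close>

lemma counting:
  fixes X :: "'u \<Rightarrow> 'a set"
  assumes U: "finite U" and X: "\<And>u. u \<in> U \<Longrightarrow> finite (X u)" and E: "finite E"
    and st: "\<And>e. e \<in> E \<Longrightarrow> s e \<in> U \<and> t e \<in> U \<and> s e \<noteq> t e"
    and inj: "inj_on (\<lambda>e. {s e, t e}) E"
    and reg: "\<And>e. e \<in> E \<Longrightarrow> cut_regular \<eta> (R e) (X (s e)) (X (t e))"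
  shows "\<bar>real (card {f \<in> Pi\<^sub>E U X. \<forall>e\<in>E. (f (s e), f (t e)) \<in> R e}) -
      (\<Prod>e\<in>E. edge_density (R e) (X (s e)) (X (t e))) * (\<Prod>u\<in>U. real (card (X u)))\<bar>
    \<le> real (card E) * \<eta> * (\<Prod>u\<in>U. real (card (X u)))"
  using E st inj reg
proof (induction E)
  case empty
  then show ?case using U by (simp add: card_PiE)
next
  case (insert e E)
  let ?P = "\<Prod>u\<in>U. real (card (X u))"
  let ?d = "\<lambda>e. edge_density (R e) (X (s e)) (X (t e))"
  let ?N = "\<lambda>E. real (card {f \<in> Pi\<^sub>E U X. \<forall>e\<in>E. (f (s e), f (t e)) \<in> R e})"
  \<comment> \<open>The earlier constraints are split by whether they involve \<open>t e\<close>: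
    \<open>QA\<close> ignores the value at \<open>t e\<close>, and \<open>QB\<close> will turn out
    to ignore the value at \<open>s e\<close>.\<close>
  define QA where "QA f \<longleftrightarrow> (\<forall>i\<in>E. s i \<noteq> t e \<and> t i \<noteq> t e \<longrightarrow> (f (s i), f (t i)) \<in> R i)" for f
  define QB where "QB f \<longleftrightarrow> (\<forall>i\<in>E. s i = t e \<or> t i = t e \<longrightarrow> (f (s i), f (t i)) \<in> R i)" for f
  have e: "s e \<in> U" "t e \<in> U" "s e \<noteq> t e" using insert.prems(1)[of e] by auto
  \<comment> \<open>Distinct edges have distinct sets of ends, so an edge through \<open>t e\<close>
    other than \<open>e\<close> misses \<open>s e\<close>.\<close>
  have other: "s i \<noteq> s e \<and> t i \<noteq> s e" if "i \<in> E" "s i = t e \<or> t i = t e" for i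
  proof -
    have "i \<noteq> e" using that insert.hyps by auto
    then have "{s i, t i} \<noteq> {s e, t e}"
      using insert.prems(2) that(1) by (auto simp: inj_on_def)
    moreover have "s i \<noteq> t i" using insert.prems(1)[of i] that(1) by auto
    ultimately show ?thesis using that(2) e(3) by (auto simp: doubleton_eq_iff)
  qed
  have QA: "QA (f(t e := y)) = QA f" for f y by (auto simp: QA_def)
  have QB: "QB (f(s e := x)) = QB f" for f x
    unfolding QB_def using other by (intro ball_cong) auto
  have one: "\<bar>real (card {f \<in> Pi\<^sub>E U X. (QA f \<and> QB f) \<and> (f (s e), f (t e)) \<in> R e}) -
      ?d e * real (card {f \<in> Pi\<^sub>E U X. QA f \<and> QB f})\<bar> \<le> \<eta> * ?P"
    by (rule counting_one_edge[where QA = QA and QB = QB, OF U e X insert.prems(3) QA QB]) simp_all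
  have "QA f \<and> QB f \<longleftrightarrow> (\<forall>i\<in>E. (f (s i), f (t i)) \<in> R i)" for f
    unfolding QA_def QB_def by blast
  then have "\<bar>?N (insert e E) - ?d e * ?N E\<bar> \<le> \<eta> * ?P"
    using one by (simp add: conj_commute)
  moreover have "\<bar>?d e * ?N E - ?d e * ((\<Prod>e\<in>E. ?d e) * ?P)\<bar> \<le> real (card E) * \<eta> * ?P"
  proof -
    have IH: "\<bar>?N E - (\<Prod>e\<in>E. ?d e) * ?P\<bar> \<le> real (card E) * \<eta> * ?P"
      by (rule insert.IH) (use insert.prems in \<open>auto simp: inj_on_def\<close>)
    have d: "0 \<le> ?d e" "?d e \<le> 1"
      using e X by (auto intro: edge_density_nonneg edge_density_le_1)
    have "\<bar>?d e * ?N E - ?d e * ((\<Prod>e\<in>E. ?d e) * ?P)\<bar> = ?d e * \<bar>?N E - (\<Prod>e\<in>E. ?d e) * ?P\<bar>"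
      using d by (simp add: abs_mult flip: right_diff_distrib)
    also have "\<dots> \<le> 1 * \<bar>?N E - (\<Prod>e\<in>E. ?d e) * ?P\<bar>"
      using d by (intro mult_right_mono) auto
    finally show ?thesis using IH unfolding mult_1_left by (rule order_trans)
  qed
  ultimately have "\<bar>?N (insert e E) - ?d e * ((\<Prod>e\<in>E. ?d e) * ?P)\<bar> \<le> \<eta> * ?P + real (card E) * \<eta> * ?P"
    by linarith
  then show ?case
    using insert.hyps by (simp add: algebra_simps)
qed

section \<open>Removal lemma for maps of a simple graph\<close>

text \<open>The low-density pairs form a union of cells, so summing the indicator of
  \<open>R\<close> over them equals summing the densities, each below \<open>d\<close>.\<close>

lemma card_low_density_edges:
  assumes "finite V" "d \<ge> 0"
  shows "real (card {(x, y) \<in> V \<times> V. (x, y) \<in> R \<and> edge_density R (atom_of V \<A> x) (atom_of V \<A> y) < d})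
    \<le> d * (real (card V))\<^sup>2"
proof -
  let ?g = "cell_avg (V \<times> V) (atom_pair V \<A>) (indicator R)"
  let ?h = "\<lambda>w. if ?g w < d then 1 else 0 :: real"
  have fV: "finite (V \<times> V)" using assms by simp
  have "{(x, y) \<in> V \<times> V. (x, y) \<in> R \<and> edge_density R (atom_of V \<A> x) (atom_of V \<A> y) < d}
      = R \<inter> {w \<in> V \<times> V. ?g w < d}"
    using assms(1) by (auto simp: cell_avg_atom_pair)
  then have "real (card {(x, y) \<in> V \<times> V. (x, y) \<in> R \<and> edge_density R (atom_of V \<A> x) (atom_of V \<A> y) < d})
      = (\<Sum>w\<in>{w \<in> V \<times> V. ?g w < d}. indicator R w)"
    using fV by (simp add: sum_indicator_card)
  also have "\<dots> = (\<Sum>w\<in>V \<times> V. indicator R w * ?h w)"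
    using fV by (simp add: sum.inter_filter if_distrib cong: if_cong)
  also have "\<dots> = (\<Sum>w\<in>V \<times> V. ?g w * ?h w)"
    by (rule sum_cell_avg_mult[OF fV, symmetric])
      (use cell_avg_cong[of "atom_pair V \<A>"] in metis)
  also have "\<dots> \<le> (\<Sum>w\<in>V \<times> V. d)"
    using assms(2) by (intro sum_mono) auto
  finally show ?thesis by (simp add: card_cartesian_product power2_eq_square mult.commute)
qed

text \<open>The points are covered by at most \<open>2 ^ M\<close> atoms of fewer than
  \<open>\<beta>\<close> points each.\<close>

lemma card_small_atoms:
  assumes "finite V" "finite \<A>" "card \<A> \<le> M" "\<beta> \<ge> 0"
  shows "real (card {x \<in> V. real (card (atom_of V \<A> x)) < \<beta>}) \<le> 2 ^ M * \<beta>"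
proof -
  let ?S = "{x \<in> V. real (card (atom_of V \<A> x)) < \<beta>}"
  let ?At = "atom_of V \<A> ` ?S"
  note at = finite_atoms_card_atoms[OF assms(2), of V]
  have sub: "?At \<subseteq> atom_of V \<A> ` V" by auto
  have fin: "finite ?At" using sub at(1) by (rule finite_subset)
  have "?S \<subseteq> \<Union>?At" using atom_of_self by fastforce
  moreover have "finite (\<Union>?At)" using fin assms(1) by (auto intro: finite_atom_of)
  ultimately have "card ?S \<le> card (\<Union>?At)" by (intro card_mono)
  also have "\<dots> \<le> (\<Sum>Y\<in>?At. card Y)" by (rule card_Union_le_sum_card)
  finally have "real (card ?S) \<le> (\<Sum>Y\<in>?At. real (card Y))" by (simp flip: of_nat_sum)
  also have "\<dots> \<le> (\<Sum>Y\<in>?At. \<beta>)" by (rule sum_mono) auto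
  also have "\<dots> = real (card ?At) * \<beta>" by simp
  also have "\<dots> \<le> 2 ^ M * \<beta>"
  proof (rule mult_right_mono)
    have "card ?At \<le> 2 ^ card \<A>" using card_mono[OF at(1) sub] at(2) by linarith
    also have "\<dots> \<le> 2 ^ M" using assms(3) by (intro power_increasing) auto
    finally have "real (card ?At) \<le> real (2 ^ M)" by (simp only: of_nat_le_iff)
    then show "real (card ?At) \<le> 2 ^ M" by simp
  qed (rule assms(4))
  finally show ?thesis .
qed

text \<open>A map \<open>f\<close> surviving the deletion singles out atoms that are large, and
  regular and dense along every edge. Counting maps into these atoms produces more maps than the
  hypothesis allows.\<close>

lemma partite_removal:
  fixes \<epsilon> :: real and s t :: "'i \<Rightarrow> 'u"
  assumes U: "finite U" and E: "finite E"
    and st: "\<And>e. e \<in> E \<Longrightarrow> s e \<in> U \<and> t e \<in> U \<and> s e \<noteq> t e"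
    and inj: "inj_on (\<lambda>e. {s e, t e}) E" and eps: "\<epsilon> > 0"
  shows "\<exists>\<delta>>0. \<forall>(V :: 'a set) R. finite V \<longrightarrow> (\<forall>e\<in>E. R e \<subseteq> V \<times> V) \<longrightarrow>
    real (card {f \<in> U \<rightarrow>\<^sub>E V. \<forall>e\<in>E. (f (s e), f (t e)) \<in> R e}) \<le> \<delta> * real (card V) ^ card U \<longrightarrow>
    (\<exists>D. (\<forall>e\<in>E. D e \<subseteq> R e \<and> real (card (D e)) \<le> \<epsilon> * (real (card V))\<^sup>2) \<and>
      (\<forall>f\<in>U \<rightarrow>\<^sub>E V. \<exists>e\<in>E. (f (s e), f (t e)) \<notin> R e - D e))"
proof -
  define m where "m = card E"
  \<comment> \<open>Irregular pairs, sparse pairs, and pairs with a small first or second atom each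
    get a quarter of \<open>\<epsilon>\<close>. The second bound in \<open>\<eta>\<close> keeps the
    counting error \<open>m * \<eta>\<close> below half of the main term
    \<open>d ^ m\<close>.\<close>
  define d where "d = \<epsilon> / 4"
  define \<eta> where "\<eta> = min (\<epsilon> / 4) (d ^ m / (2 * (real m + 1)))"
  have d: "d > 0" using eps by (simp add: d_def)
  have eta: "\<eta> > 0" using d eps by (simp add: \<eta>_def)
  obtain M where M: "\<And>(V :: 'a set) R. finite V \<Longrightarrow> \<exists>\<A>. finite \<A> \<and> card \<A> \<le> M \<and>
      (\<forall>e\<in>E. real (card (irregular V \<A> \<eta> (R e))) \<le> \<eta> * (real (card V))\<^sup>2)"
    using regularity[OF E eta] by blast
  \<comment> \<open>At most \<open>2 ^ M\<close> atoms are small, so vertices in small atoms make up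
    at most a quarter of \<open>\<epsilon>\<close>; \<open>\<beta> \<le> 1\<close> lets
    \<open>V\<close> itself count as large.\<close>
  define \<beta> where "\<beta> = min 1 (\<epsilon> / (4 * 2 ^ M))"
  have beta: "\<beta> > 0" "\<beta> \<le> 1" using eps by (simp_all add: \<beta>_def)
  have beta_M: "2 ^ M * \<beta> \<le> \<epsilon> / 4"
  proof -
    have "2 ^ M * \<beta> \<le> 2 ^ M * (\<epsilon> / (4 * 2 ^ M))"
      unfolding \<beta>_def by (rule mult_left_mono) auto
    then show ?thesis by simp
  qed
  \<comment> \<open>One factor 2 pays for the counting error, the other makes the final
    contradiction strict.\<close>
  define \<delta> where "\<delta> = d ^ m * \<beta> ^ card U / 4"
  have delta: "\<delta> > 0" using d beta by (simp add: \<delta>_def)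
  have meta: "real m * \<eta> \<le> d ^ m / 2"
  proof -
    have "\<eta> * (2 * (real m + 1)) \<le> d ^ m"
      unfolding \<eta>_def by (subst pos_le_divide_eq[symmetric]) auto
    then show ?thesis using eta by (simp add: algebra_simps)
  qed
  have "\<exists>D. (\<forall>e\<in>E. D e \<subseteq> R e \<and> real (card (D e)) \<le> \<epsilon> * (real (card V))\<^sup>2) \<and>
      (\<forall>f\<in>U \<rightarrow>\<^sub>E V. \<exists>e\<in>E. (f (s e), f (t e)) \<notin> R e - D e)"
    if V: "finite V" and R: "\<forall>e\<in>E. R e \<subseteq> V \<times> V"
      and few: "real (card {f \<in> U \<rightarrow>\<^sub>E V. \<forall>e\<in>E. (f (s e), f (t e)) \<in> R e}) \<le> \<delta> * real (card V) ^ card U"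
    for V :: "'a set" and R
  proof -
    let ?n = "real (card V)"
    obtain \<A> where A: "finite \<A>" "card \<A> \<le> M"
      and irr: "\<And>e. e \<in> E \<Longrightarrow> real (card (irregular V \<A> \<eta> (R e))) \<le> \<eta> * ?n\<^sup>2"
      using M[OF V, of R] by blast
    let ?at = "atom_of V \<A>"
    define small where "small = {x \<in> V. real (card (?at x)) < \<beta> * ?n}"
    define low where "low e = {(x, y) \<in> V \<times> V. (x, y) \<in> R e \<and> edge_density (R e) (?at x) (?at y) < d}" for e
    define D where "D e = R e \<inter> (irregular V \<A> \<eta> (R e) \<union> low e \<union> small \<times> V \<union> V \<times> small)" for e
    have fs: "finite small" "finite (low e)" "finite (irregular V \<A> \<eta> (R e))" for e
      using V by (auto simp: small_def low_def irregular_def intro: rev_finite_subset[of "V \<times> V"])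
    have "real (card small) \<le> \<epsilon> / 4 * ?n"
    proof -
      have "real (card small) \<le> 2 ^ M * (\<beta> * ?n)"
        unfolding small_def using beta by (intro card_small_atoms[OF V A]) simp
      also have "\<dots> = 2 ^ M * \<beta> * ?n" by simp
      also have "\<dots> \<le> \<epsilon> / 4 * ?n" by (rule mult_right_mono[OF beta_M]) simp
      finally show ?thesis .
    qed
    then have csm: "real (card small) * ?n \<le> \<epsilon> / 4 * ?n\<^sup>2"
      using mult_right_mono[of "real (card small)" "\<epsilon> / 4 * ?n" ?n] by (simp add: power2_eq_square)
    have cD: "real (card (D e)) \<le> \<epsilon> * ?n\<^sup>2" if e: "e \<in> E" for e
    proof -
      have "card (D e) \<le> card (irregular V \<A> \<eta> (R e) \<union> low e \<union> small \<times> V \<union> V \<times> small)"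
        unfolding D_def using fs V by (intro card_mono) auto
      also have "\<dots> \<le> card (irregular V \<A> \<eta> (R e)) + card (low e) + card (small \<times> V) + card (V \<times> small)"
        by (intro order_trans[OF card_Un_le] add_mono card_Un_le) auto
      finally have "real (card (D e)) \<le> real (card (irregular V \<A> \<eta> (R e))) + real (card (low e))
          + 2 * (real (card small) * ?n)"
        by (simp add: card_cartesian_product mult.commute flip: of_nat_mult of_nat_add)
      moreover have "real (card (irregular V \<A> \<eta> (R e))) \<le> \<epsilon> / 4 * ?n\<^sup>2"
        by (rule order_trans[OF irr[OF e] mult_right_mono]) (simp_all only: \<eta>_def min.cobounded1 zero_le_power2)
      moreover have "real (card (low e)) \<le> \<epsilon> / 4 * ?n\<^sup>2"
        using card_low_density_edges[OF V, of d "R e" \<A>] d by (simp add: low_def d_def)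
      ultimately show ?thesis using csm by linarith
    qed
    have "\<exists>e\<in>E. (f (s e), f (t e)) \<notin> R e - D e" if f: "f \<in> U \<rightarrow>\<^sub>E V" for f
    proof (rule ccontr)
      assume "\<not> (\<exists>e\<in>E. (f (s e), f (t e)) \<notin> R e - D e)"
      then have good: "(f (s e), f (t e)) \<in> R e" "(f (s e), f (t e)) \<notin> D e" if "e \<in> E" for e
        using that by auto
      have fV: "f u \<in> V" if "u \<in> U" for u using f that by auto
      \<comment> \<open>the atom of an isolated vertex may be small, so it is replaced by \<open>V\<close>\<close>
      define X where "X u = (if \<exists>e\<in>E. u = s e \<or> u = t e then ?at (f u) else V)" for u
      have X: "finite (X u)" for u using V by (simp add: X_def finite_atom_of)
      have XV: "X u \<subseteq> V" for u by (simp add: X_def atom_of_subset)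
      have Xst: "X (s e) = ?at (f (s e))" "X (t e) = ?at (f (t e))" if "e \<in> E" for e
        using that by (auto simp: X_def)
      have reg: "cut_regular \<eta> (R e) (X (s e)) (X (t e))" if e: "e \<in> E" for e
        using good[OF e] st[OF e] fV unfolding Xst[OF e] D_def irregular_def by auto
      have dens: "d \<le> edge_density (R e) (X (s e)) (X (t e))" if e: "e \<in> E" for e
        using good[OF e] st[OF e] fV unfolding Xst[OF e] D_def low_def by (auto simp: not_less)
      let ?P = "\<Prod>u\<in>U. real (card (X u))"
      have large: "\<beta> * ?n \<le> real (card (X u))" if u: "u \<in> U" for u
      proof (cases "\<exists>e\<in>E. u = s e \<or> u = t e")
        case True
        then obtain e where e: "e \<in> E" "u = s e \<or> u = t e" by blast
        have "f u \<notin> small" using good[OF e(1)] e(2) st[OF e(1)] fV unfolding D_def by auto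
        then show ?thesis using True fV[OF u] by (simp add: X_def small_def)
      next
        case False
        then show ?thesis using beta by (simp add: X_def mult_left_le_one_le)
      qed
      have "(\<beta> * ?n) ^ card U \<le> ?P"
        using prod_mono[of U "\<lambda>_. \<beta> * ?n" "\<lambda>u. real (card (X u))"] large beta by simp
      then have "d ^ m / 2 * (\<beta> * ?n) ^ card U \<le> d ^ m / 2 * ?P"
        using d by (intro mult_left_mono) auto
      moreover have "d ^ m / 2 * (\<beta> * ?n) ^ card U = 2 * (\<delta> * ?n ^ card U)"
        by (simp add: \<delta>_def power_mult_distrib)
      \<comment> \<open>If \<open>V\<close> is empty, the existence of \<open>f\<close> forces
        \<open>U\<close> to be empty, and then the power is 1.\<close>
      moreover have "\<delta> * ?n ^ card U > 0"
      proof -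
        have "U = {} \<or> card V > 0" using fV V by (auto simp: card_gt_0_iff)
        then show ?thesis using delta by auto
      qed
      ultimately have low_P: "\<delta> * ?n ^ card U < d ^ m / 2 * ?P" by linarith
      have "d ^ m \<le> (\<Prod>e\<in>E. edge_density (R e) (X (s e)) (X (t e)))"
        using prod_mono[of E "\<lambda>_. d" "\<lambda>e. edge_density (R e) (X (s e)) (X (t e))"] dens d
        by (simp add: m_def)
      then have "d ^ m * ?P \<le> (\<Prod>e\<in>E. edge_density (R e) (X (s e)) (X (t e))) * ?P"
        by (intro mult_right_mono prod_nonneg) auto
      moreover have "real m * \<eta> * ?P \<le> d ^ m / 2 * ?P"
        using meta by (intro mult_right_mono prod_nonneg) auto
      moreover have "\<bar>real (card {f \<in> Pi\<^sub>E U X. \<forall>e\<in>E. (f (s e), f (t e)) \<in> R e}) -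
          (\<Prod>e\<in>E. edge_density (R e) (X (s e)) (X (t e))) * ?P\<bar> \<le> real m * \<eta> * ?P"
        unfolding m_def by (rule counting[OF U X E st inj reg])
      ultimately have "d ^ m / 2 * ?P \<le> real (card {f \<in> Pi\<^sub>E U X. \<forall>e\<in>E. (f (s e), f (t e)) \<in> R e})"
        by linarith
      also have "\<dots> \<le> real (card {f \<in> U \<rightarrow>\<^sub>E V. \<forall>e\<in>E. (f (s e), f (t e)) \<in> R e})"
      proof (rule of_nat_mono[OF card_mono])
        show "finite {f \<in> U \<rightarrow>\<^sub>E V. \<forall>e\<in>E. (f (s e), f (t e)) \<in> R e}"
          using finite_PiE[OF U, of "\<lambda>_. V"] V by simp
        show "{f \<in> Pi\<^sub>E U X. \<forall>e\<in>E. (f (s e), f (t e)) \<in> R e} \<subseteq>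
            {f \<in> U \<rightarrow>\<^sub>E V. \<forall>e\<in>E. (f (s e), f (t e)) \<in> R e}"
          using PiE_mono[of U X "\<lambda>_. V"] XV by auto
      qed
      finally show False using low_P few by linarith
    qed
    then show ?thesis using cD by (intro exI[of _ D]) (auto simp: D_def)
  qed
  then show ?thesis using delta by blast
qed

section \<open>Noninjective maps\<close>

text \<open>A noninjective map identifies some \<open>u\<close> and \<open>v\<close>, and is then
  determined by its restriction to \<open>U - {v}\<close>. The factor \<open>card V\<close> on the
  left replaces the exponent \<open>card U - 1\<close>.\<close>

lemma card_noninjective_le:
  assumes U: "finite U" and V: "finite V"
  shows "card {f \<in> U \<rightarrow>\<^sub>E V. \<not> inj_on f U} * card V \<le> (card U)\<^sup>2 * card V ^ card U"
proof -
  let ?I = "{(u, v) \<in> U \<times> U. u \<noteq> v}"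
  let ?F = "\<lambda>(u, v). {f \<in> U \<rightarrow>\<^sub>E V. f u = f v}"
  have fin: "finite (U \<rightarrow>\<^sub>E V)" using assms by (intro finite_PiE)
  have finI: "finite ?I" using U by (auto intro: rev_finite_subset[of "U \<times> U"])
  have each: "card (?F p) * card V \<le> card V ^ card U" if "p \<in> ?I" for p
  proof -
    obtain u v where p: "p = (u, v)" "u \<in> U" "v \<in> U" "u \<noteq> v" using \<open>p \<in> ?I\<close> by auto
    have "card (?F p) \<le> card ((U - {v}) \<rightarrow>\<^sub>E V)"
    proof (rule card_inj_on_le[where f = "\<lambda>f. restrict f (U - {v})"])
      show "inj_on (\<lambda>f. restrict f (U - {v})) (?F p)"
      proof (rule inj_onI)
        fix f g assume fg: "f \<in> ?F p" "g \<in> ?F p" "restrict f (U - {v}) = restrict g (U - {v})"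
        have eq: "f w = g w" if "w \<in> U - {v}" for w
          using fun_cong[OF fg(3), of w] that by simp
        show "f = g"
        proof (rule PiE_ext)
          show "f \<in> U \<rightarrow>\<^sub>E V" "g \<in> U \<rightarrow>\<^sub>E V" using fg p by auto
          show "f w = g w" if "w \<in> U" for w
            using eq[of w] eq[of u] that fg p by (cases "w = v") auto
        qed
      qed
      show "(\<lambda>f. restrict f (U - {v})) ` ?F p \<subseteq> (U - {v}) \<rightarrow>\<^sub>E V"
      proof (rule image_subsetI)
        fix f assume "f \<in> ?F p"
        then have "f \<in> U \<rightarrow>\<^sub>E V" using p by auto
        then show "restrict f (U - {v}) \<in> (U - {v}) \<rightarrow>\<^sub>E V" by (intro restrict_PiE_iff[THEN iffD2]) auto
      qed
      show "finite ((U - {v}) \<rightarrow>\<^sub>E V)" using assms by (intro finite_PiE) auto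
    qed
    also have "\<dots> = card V ^ (card U - 1)" using U p by (simp add: card_PiE)
    finally have "card (?F p) * card V \<le> card V ^ (card U - 1) * card V" by (rule mult_right_mono) simp
    also have "\<dots> = card V ^ Suc (card U - 1)" by simp
    also have "Suc (card U - 1) = card U" using U p by (metis card_gt_0_iff empty_iff Suc_diff_1)
    finally show ?thesis .
  qed
  have "{f \<in> U \<rightarrow>\<^sub>E V. \<not> inj_on f U} \<subseteq> (\<Union>p\<in>?I. ?F p)"
    by (auto simp: inj_on_def)
  moreover have "finite (\<Union>p\<in>?I. ?F p)" by (rule finite_subset[OF _ fin]) auto
  ultimately have "card {f \<in> U \<rightarrow>\<^sub>E V. \<not> inj_on f U} \<le> card (\<Union>p\<in>?I. ?F p)" by (intro card_mono)
  also have "\<dots> \<le> (\<Sum>p\<in>?I. card (?F p))" by (rule card_UN_le[OF finI])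
  finally have "card {f \<in> U \<rightarrow>\<^sub>E V. \<not> inj_on f U} * card V \<le> (\<Sum>p\<in>?I. card (?F p)) * card V"
    by (rule mult_right_mono) simp
  also have "\<dots> = (\<Sum>p\<in>?I. card (?F p) * card V)" by (rule sum_distrib_right)
  also have "\<dots> \<le> (\<Sum>p\<in>?I. card V ^ card U)" by (rule sum_mono) (rule each)
  also have "\<dots> = card ?I * card V ^ card U" by simp
  also have "\<dots> \<le> (card U)\<^sup>2 * card V ^ card U"
  proof (rule mult_right_mono)
    have "card ?I \<le> card (U \<times> U)" using U by (intro card_mono) auto
    then show "card ?I \<le> (card U)\<^sup>2" by (simp add: card_cartesian_product power2_eq_square)
  qed simp
  finally show ?thesis .
qed

section \<open>Rainbow copies\<close>

text \<open>Each edge has its own set of admissible pairs, so parallel edges may lie in different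
  graphs. Extensionality keeps the set finite.\<close>

definition embeddings ::
  "('v, 'e) multigraph \<Rightarrow> 'a set \<Rightarrow> ('e \<Rightarrow> 'a set set) \<Rightarrow> ('v \<Rightarrow> 'a) set" where
  "embeddings H V F =
     {f \<in> verts H \<rightarrow>\<^sub>E V. inj_on f (verts H) \<and> (\<forall>e\<in>edges H. f ` ends H e \<in> F e)}"

text \<open>Parallel edges constrain the same pair of vertices, so they are merged into one
  relation, the intersection of their graphs. Noninjective maps are absorbed into the bound when
  \<open>V\<close> is large.\<close>

lemma multigraph_removal:
  fixes H :: "('v, 'e) multigraph" and \<epsilon> :: real
  assumes H: "is_multigraph H" and eps: "\<epsilon> > 0"
  shows "\<exists>\<delta>>0. \<forall>(V :: 'a set) F. finite V \<longrightarrow>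
    real (card (embeddings H V F)) \<le> \<delta> * real (card V) ^ card (verts H) \<longrightarrow>
    (\<exists>D. (\<forall>e\<in>edges H. D e \<subseteq> F e \<and> real (card (D e)) \<le> \<epsilon> * (real (card V))\<^sup>2) \<and>
      embeddings H V (\<lambda>e. F e - D e) = {})"
proof -
  let ?U = "verts H" and ?h = "card (verts H)"
  \<comment> \<open>Indexing by sets of ends instead of edges gives the underlying simple graph;
    \<open>p\<close> below orients each of its edges.\<close>
  let ?E = "ends H ` edges H"
  have U: "finite ?U" and E: "finite ?E" using H by (auto simp: is_multigraph_def)
  have "\<exists>p. S = {fst p, snd p} \<and> fst p \<in> ?U \<and> snd p \<in> ?U \<and> fst p \<noteq> snd p" if "S \<in> ?E" for S
  proof -
    have "S \<in> pairs_of ?U" using that H by (auto simp: is_multigraph_def)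
    then show ?thesis by (force simp: pairs_of_def)
  qed
  then obtain p where p: "\<And>S. S \<in> ?E \<Longrightarrow>
      S = {fst (p S), snd (p S)} \<and> fst (p S) \<in> ?U \<and> snd (p S) \<in> ?U \<and> fst (p S) \<noteq> snd (p S)"
    by metis
  define s where "s S = fst (p S)" for S
  define t where "t S = snd (p S)" for S
  have ends: "ends H e = {s (ends H e), t (ends H e)}" if "e \<in> edges H" for e
    using p[of "ends H e"] that by (auto simp: s_def t_def)
  have st: "s S \<in> ?U \<and> t S \<in> ?U \<and> s S \<noteq> t S" if "S \<in> ?E" for S
    using p[OF that] by (simp add: s_def t_def)
  have inj: "inj_on (\<lambda>S. {s S, t S}) ?E"
    using p by (intro inj_onI) (metis s_def t_def)
  obtain \<delta>' where delta': "\<delta>' > 0" and rem: "\<And>(V :: 'a set) R. finite V \<Longrightarrow> (\<forall>S\<in>?E. R S \<subseteq> V \<times> V) \<Longrightarrow>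
      real (card {f \<in> ?U \<rightarrow>\<^sub>E V. \<forall>S\<in>?E. (f (s S), f (t S)) \<in> R S}) \<le> \<delta>' * real (card V) ^ ?h \<Longrightarrow>
      (\<exists>D. (\<forall>S\<in>?E. D S \<subseteq> R S \<and> real (card (D S)) \<le> \<epsilon> * (real (card V))\<^sup>2) \<and>
        (\<forall>f\<in>?U \<rightarrow>\<^sub>E V. \<exists>S\<in>?E. (f (s S), f (t S)) \<notin> R S - D S))"
    using partite_removal[OF U E st inj eps, where ?'a = 'a] by blast
  \<comment> \<open>From \<open>n0\<close> vertices on, the at most
    \<open>h\<^sup>2 * n ^ (h - 1)\<close> noninjective maps use at most half of
    \<open>\<delta>'\<close>.\<close>
  obtain n0 :: nat where n0: "n0 > 0" "real n0 \<ge> 2 * (real ?h)\<^sup>2 / \<delta>'"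
    by (metis gr0I of_nat_0_less_iff real_arch_simple le_max_iff_disj max.cobounded1 max.cobounded2
        of_nat_le_iff order_trans zero_less_one less_le_trans)
  \<comment> \<open>The first bound leaves half of \<open>\<delta>'\<close> to the embeddings; the
    second makes the allowed number of embeddings less than 1 when
    \<open>card V \<le> n0\<close>.\<close>
  define \<delta> where "\<delta> = min (\<delta>' / 2) (1 / (2 * real n0 ^ ?h))"
  have delta: "\<delta> > 0" using delta' n0(1) by (simp add: \<delta>_def)
  have "\<exists>D. (\<forall>e\<in>edges H. D e \<subseteq> F e \<and> real (card (D e)) \<le> \<epsilon> * (real (card V))\<^sup>2) \<and>
      embeddings H V (\<lambda>e. F e - D e) = {}"
    if V: "finite V" and few: "real (card (embeddings H V F)) \<le> \<delta> * real (card V) ^ ?h"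
    for V :: "'a set" and F
  \<comment> \<open>below \<open>n0\<close> the bound forces zero copies; above it, noninjective maps are negligible\<close>
  proof (cases "card V \<le> n0")
    case True
    have finPi: "finite (?U \<rightarrow>\<^sub>E V)" using U V by (intro finite_PiE)
    have "\<delta> * real (card V) ^ ?h \<le> 1 / (2 * real n0 ^ ?h) * real n0 ^ ?h"
      using True delta by (intro mult_mono power_mono) (auto simp: \<delta>_def)
    also have "\<dots> < 1" using n0(1) by simp
    finally have "card (embeddings H V F) = 0" using few by linarith
    moreover have "finite (embeddings H V F)"
      using finPi by (simp add: embeddings_def)
    ultimately have "embeddings H V F = {}" by simp
    then show ?thesis using eps by (intro exI[of _ "\<lambda>_. {}"]) simp
  next
    case False
    let ?n = "real (card V)"
    define R where "R S = {(x, y) \<in> V \<times> V. \<forall>e\<in>edges H. ends H e = S \<longrightarrow> {x, y} \<in> F e}" for S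
    let ?hom = "{f \<in> ?U \<rightarrow>\<^sub>E V. \<forall>S\<in>?E. (f (s S), f (t S)) \<in> R S}"
    let ?non = "{f \<in> ?U \<rightarrow>\<^sub>E V. \<not> inj_on f ?U}"
    have finPi: "finite (?U \<rightarrow>\<^sub>E V)" using U V by (intro finite_PiE)
    have img: "f ` ends H e = {f (s (ends H e)), f (t (ends H e))}" if "e \<in> edges H" for f :: "'v \<Rightarrow> 'a" and e
      by (subst ends[OF that]) simp
    have "?hom \<subseteq> embeddings H V F \<union> ?non"
      using img by (auto simp: embeddings_def R_def)
    then have "card ?hom \<le> card (embeddings H V F \<union> ?non)"
      using finPi by (intro card_mono) (auto simp: embeddings_def)
    also have "\<dots> \<le> card (embeddings H V F) + card ?non" by (rule card_Un_le)
    finally have "real (card ?hom) \<le> real (card (embeddings H V F)) + real (card ?non)"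
      by (simp flip: of_nat_add)
    moreover have "real (card (embeddings H V F)) \<le> \<delta>' / 2 * ?n ^ ?h"
      by (rule order_trans[OF few]) (intro mult_right_mono, auto simp: \<delta>_def)
    moreover have "real (card ?non) \<le> \<delta>' / 2 * ?n ^ ?h"
    proof -
      have n: "?n > 0" "real n0 \<le> ?n" using False by auto
      have "2 * (real ?h)\<^sup>2 \<le> \<delta>' * ?n"
        using order_trans[OF n0(2) n(2)] delta' by (simp add: pos_divide_le_eq mult.commute)
      then have "(real ?h)\<^sup>2 * ?n ^ ?h \<le> \<delta>' / 2 * ?n * ?n ^ ?h"
        by (intro mult_right_mono) auto
      moreover have "real (card ?non) * ?n \<le> (real ?h)\<^sup>2 * ?n ^ ?h"
        using of_nat_mono[OF card_noninjective_le[OF U V], where ?'a = real] by simp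
      ultimately have "real (card ?non) * ?n \<le> (\<delta>' / 2 * ?n ^ ?h) * ?n"
        by (simp add: mult_ac)
      then show ?thesis using n(1) by (simp only: mult_le_cancel_right_pos)
    qed
    ultimately have few_hom: "real (card ?hom) \<le> \<delta>' * ?n ^ ?h" by simp
    have sub: "\<forall>S\<in>?E. R S \<subseteq> V \<times> V" by (auto simp: R_def)
    obtain D where D: "\<And>S. S \<in> ?E \<Longrightarrow> D S \<subseteq> R S \<and> real (card (D S)) \<le> \<epsilon> * ?n\<^sup>2"
      and free: "\<And>f. f \<in> ?U \<rightarrow>\<^sub>E V \<Longrightarrow> \<exists>S\<in>?E. (f (s S), f (t S)) \<notin> R S - D S"
      using rem[OF V sub few_hom] by metis
    \<comment> \<open>A deleted ordered pair is forgotten to an unordered one and removed for every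
      edge with these ends; this cannot increase the cardinality.\<close>
    define D' where "D' e = (\<lambda>(x, y). {x, y}) ` D (ends H e)" for e
    have "D' e \<subseteq> F e \<and> real (card (D' e)) \<le> \<epsilon> * ?n\<^sup>2" if e: "e \<in> edges H" for e
    proof
      have De: "D (ends H e) \<subseteq> R (ends H e)" "real (card (D (ends H e))) \<le> \<epsilon> * ?n\<^sup>2"
        using D[of "ends H e"] e by auto
      show "D' e \<subseteq> F e" using De(1) e by (auto simp: D'_def R_def)
      have "finite (D (ends H e))"
        using De(1) V by (auto simp: R_def intro: rev_finite_subset[of "V \<times> V"])
      then have "card (D' e) \<le> card (D (ends H e))" unfolding D'_def by (rule card_image_le)
      then show "real (card (D' e)) \<le> \<epsilon> * ?n\<^sup>2" using De(2) by linarith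
    qed
    moreover have "f \<notin> embeddings H V (\<lambda>e. F e - D' e)" for f
    proof
      assume f: "f \<in> embeddings H V (\<lambda>e. F e - D' e)"
      then have fV: "f \<in> ?U \<rightarrow>\<^sub>E V" by (simp add: embeddings_def)
      then obtain S where S: "S \<in> ?E" "(f (s S), f (t S)) \<notin> R S - D S" using free by blast
      obtain e0 where e0: "e0 \<in> edges H" "S = ends H e0" using S(1) by blast
      have "{f (s S), f (t S)} \<in> F e - D' e" if "e \<in> edges H" "ends H e = S" for e
        using f that img[OF that(1), of f] by (auto simp: embeddings_def)
      moreover have "f (s S) \<in> V" "f (t S) \<in> V" using fV st[OF S(1)] by auto
      ultimately have "(f (s S), f (t S)) \<in> R S" "(f (s S), f (t S)) \<notin> D S"
        using e0 by (auto simp: R_def D'_def)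
      then show False using S(2) by blast
    qed
    ultimately show ?thesis by blast
  qed
  then show ?thesis using delta by blast
qed

section \<open>Rainbow copies versus embeddings\<close>

lemma finite_rainbow_copies:
  assumes "finite V"
  shows "finite (rainbow_copies k H \<psi> V G)"
proof (rule finite_subset)
  show "rainbow_copies k H \<psi> V G \<subseteq> Pow V \<times> Pow (Pow V \<times> {1..k})"
    by (fastforce simp: rainbow_copies_def rainbow_copy_def is_multigraph_def pairs_of_def)
  show "finite (Pow V \<times> Pow (Pow V \<times> {1..k}))" using assms by simp
qed

text \<open>The colorings that copies can induce on \<open>H\<close>, made extensional so that there
  are finitely many.\<close>

definition full_colorings ::
  "nat \<Rightarrow> ('v, 'e) multigraph \<Rightarrow> ('e \<Rightarrow> nat option) \<Rightarrow> ('e \<Rightarrow> nat) set" where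
  "full_colorings k H \<psi> =
     {c \<in> edges H \<rightarrow>\<^sub>E {1..k}. inj_on c (edges H) \<and> (\<forall>e\<in>dom \<psi>. \<psi> e = Some (c e))}"

lemma image_mem_pairs_of:
  assumes "S \<in> pairs_of U" "inj_on f U"
  shows "f ` S \<in> pairs_of (f ` U)"
proof -
  obtain u v where uv: "S = {u, v}" "u \<in> U" "v \<in> U" "u \<noteq> v"
    using assms(1) by (auto simp: pairs_of_def)
  then have "f u \<noteq> f v" using assms(2) by (auto dest: inj_onD)
  then show ?thesis using uv by (auto simp: pairs_of_def)
qed

text \<open>The image of \<open>H\<close> under \<open>f\<close> keeps the edge labels of
  \<open>H\<close>, so the identity serves as the edge bijection.\<close>

lemma rainbow_copy_of_embedding:
  assumes H: "is_multigraph H" and c: "c \<in> full_colorings k H \<psi>"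
    and f: "f \<in> embeddings H V (\<lambda>e. G (c e))"
  shows "(f ` verts H, (\<lambda>e. (f ` ends H e, c e)) ` edges H) \<in> rainbow_copies k H \<psi> V G"
proof -
  define H' where "H' = \<lparr>verts = f ` verts H, edges = edges H, ends = (\<lambda>e. f ` ends H e)\<rparr>"
  have inj: "inj_on f (verts H)" using f by (simp add: embeddings_def)
  have "is_multigraph H'"
    using H image_mem_pairs_of[OF _ inj] by (auto simp: is_multigraph_def H'_def)
  moreover have "multigraph_iso H H' f id"
    using inj by (auto simp: multigraph_iso_def H'_def bij_betw_def)
  ultimately have "rainbow_copy k H \<psi> V G H' c"
    unfolding rainbow_copy_def using c f
    by (auto simp: full_colorings_def embeddings_def H'_def intro!: exI[of _ f] exI[of _ id])
  then show ?thesis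
    unfolding rainbow_copies_def
    by (intro CollectI exI[of _ H'] exI[of _ c] conjI) (simp_all add: H'_def)
qed

text \<open>A copy remembers its vertex set, so the embeddings producing it all map
  \<open>verts H\<close> into one fixed set of \<open>h\<close> vertices; there are at most
  \<open>h ^ h\<close> of them. Hence few copies mean few embeddings.\<close>

lemma card_embeddings_le:
  assumes H: "is_multigraph H" and V: "finite V" and c: "c \<in> full_colorings k H \<psi>"
  shows "card (embeddings H V (\<lambda>e. G (c e))) \<le>
    card (verts H) ^ card (verts H) * card (rainbow_copies k H \<psi> V G)"
proof -
  let ?A = "embeddings H V (\<lambda>e. G (c e))" and ?h = "card (verts H)"
  let ?\<Psi> = "\<lambda>f. (f ` verts H, (\<lambda>e. (f ` ends H e, c e)) ` edges H)"
  have U: "finite (verts H)" using H by (simp add: is_multigraph_def)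
  have finA: "finite ?A" using finite_PiE[OF U, of "\<lambda>_. V"] V by (simp add: embeddings_def)
  have fiber: "card {f \<in> ?A. ?\<Psi> f = y} \<le> ?h ^ ?h" if y: "y \<in> ?\<Psi> ` ?A" for y
  proof -
    obtain g where g: "g \<in> ?A" "y = ?\<Psi> g" using y by blast
    have "{f \<in> ?A. ?\<Psi> f = y} \<subseteq> verts H \<rightarrow>\<^sub>E g ` verts H"
      using g by (auto simp: embeddings_def)
    then have "card {f \<in> ?A. ?\<Psi> f = y} \<le> card (verts H \<rightarrow>\<^sub>E g ` verts H)"
      using U by (intro card_mono finite_PiE) auto
    also have "\<dots> = ?h ^ ?h"
      using g(1) U by (simp add: card_PiE embeddings_def card_image)
    finally show ?thesis .
  qed
  have "card ?A = (\<Sum>f\<in>?A. 1)" by simp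
  also have "\<dots> = (\<Sum>y\<in>?\<Psi> ` ?A. \<Sum>f\<in>{f \<in> ?A. ?\<Psi> f = y}. 1)" by (rule sum.image_gen[OF finA])
  also have "\<dots> \<le> (\<Sum>y\<in>?\<Psi> ` ?A. ?h ^ ?h)" using fiber by (intro sum_mono) simp
  also have "\<dots> = ?h ^ ?h * card (?\<Psi> ` ?A)" by simp
  also have "card (?\<Psi> ` ?A) \<le> card (rainbow_copies k H \<psi> V G)"
    using rainbow_copy_of_embedding[OF H c]
    by (intro card_mono finite_rainbow_copies V image_subsetI)
  finally show ?thesis by simp
qed

text \<open>The coloring of the copy is pulled back along the edge bijection. Thus it is enough to
  destroy the embeddings of each full coloring.\<close>

lemma embedding_of_rainbow_copy:
  assumes H: "is_multigraph H" and pre: "rainbow_precoloring k H \<psi>"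
    and copy: "rainbow_copy k H \<psi> V G H' \<psi>'"
  shows "\<exists>c\<in>full_colorings k H \<psi>. embeddings H V (\<lambda>e. G (c e)) \<noteq> {}"
proof -
  obtain f g where iso: "multigraph_iso H H' f g" and ext: "\<forall>e\<in>dom \<psi>. \<psi> e = Some (\<psi>' (g e))"
    using copy by (auto simp: rainbow_copy_def)
  have f: "bij_betw f (verts H) (verts H')" and g: "bij_betw g (edges H) (edges H')"
    and ends: "\<And>e. e \<in> edges H \<Longrightarrow> ends H' (g e) = f ` ends H e"
    using iso by (auto simp: multigraph_iso_def)
  have H': "verts H' \<subseteq> V" "inj_on \<psi>' (edges H')" "\<psi>' ` edges H' \<subseteq> {1..k}"
    "\<And>e. e \<in> edges H' \<Longrightarrow> ends H' e \<in> G (\<psi>' e)"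
    using copy by (auto simp: rainbow_copy_def)
  let ?c = "restrict (\<psi>' \<circ> g) (edges H)" and ?f = "restrict f (verts H)"
  have dom: "dom \<psi> \<subseteq> edges H" using pre by (simp add: rainbow_precoloring_def)
  have gmem: "g e \<in> edges H'" if "e \<in> edges H" for e using g that by (auto simp: bij_betw_def)
  have "inj_on (\<psi>' \<circ> g) (edges H)"
    using g H'(2) by (auto simp: bij_betw_def intro: comp_inj_on)
  then have c: "?c \<in> full_colorings k H \<psi>"
    using gmem H'(3) ext dom by (auto simp: full_colorings_def inj_on_def)
  have sub: "ends H e \<subseteq> verts H" if "e \<in> edges H" for e
    using H that by (force simp: is_multigraph_def pairs_of_def)
  have "?f ` ends H e \<in> G (?c e)" if e: "e \<in> edges H" for e
  proof -
    have "?f ` ends H e = ends H' (g e)"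
      unfolding ends[OF e] using sub[OF e] by (intro image_cong) auto
    then show ?thesis using H'(4)[OF gmem[OF e]] e by simp
  qed
  then have "?f \<in> embeddings H V (\<lambda>e. G (?c e))"
    using f H'(1) by (auto simp: embeddings_def bij_betw_def inj_on_def)
  then show ?thesis using c by blast
qed

theorem theorem4p2:
  fixes k :: nat
    and H :: "('v, 'e) multigraph"
    and \<psi> :: "'e \<Rightarrow> nat option"
    and \<epsilon> :: real
  assumes "k \<ge> 1"
    and "is_multigraph H"
    and "rainbow_precoloring k H \<psi>"
    and "\<epsilon> > 0"
  shows "\<exists>\<delta>::real. \<delta> > 0 \<and>
    (\<forall>(V :: 'a set) (G :: nat \<Rightarrow> 'a set set).
       graph_system k V G \<longrightarrow>
       real (card (rainbow_copies k H \<psi> V G)) \<le> \<delta> * real (card V) ^ card (verts H) \<longrightarrow>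
       (\<exists>D :: nat \<Rightarrow> 'a set set.
          (\<forall>i \<in> {1..k}. D i \<subseteq> G i) \<and>
          real (\<Sum>i \<in> {1..k}. card (D i)) \<le> \<epsilon> * real (card V) ^ 2 \<and>
          rainbow_free k H \<psi> V (\<lambda>i. G i - D i)))"
proof -
  note H = assms(2)
  let ?C = "full_colorings k H \<psi>" and ?E = "edges H" and ?h = "card (verts H)"
  have E: "finite ?E" using H by (simp add: is_multigraph_def)
  have C: "finite ?C" using finite_PiE[OF E, of "\<lambda>_. {1..k}"] by (simp add: full_colorings_def)
  \<comment> \<open>\<open>N\<close> counts the pairs of a coloring and an edge, each of which
    triggers one deletion; the added 1 keeps the quotient defined when \<open>N\<close> is
    0.\<close>
  define N where "N = card ?C * card ?E"
  define \<epsilon>' where "\<epsilon>' = \<epsilon> / (real N + 1)"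
  have eps': "\<epsilon>' > 0" using assms(4) by (simp add: \<epsilon>'_def)
  have eps'_N: "real N * \<epsilon>' \<le> \<epsilon>" using assms(4) by (simp add: \<epsilon>'_def field_simps)
  obtain \<delta>' where delta': "\<delta>' > 0" and rem: "\<And>(V :: 'a set) F. finite V \<Longrightarrow>
      real (card (embeddings H V F)) \<le> \<delta>' * real (card V) ^ ?h \<Longrightarrow>
      \<exists>D. (\<forall>e\<in>?E. D e \<subseteq> F e \<and> real (card (D e)) \<le> \<epsilon>' * (real (card V))\<^sup>2) \<and>
        embeddings H V (\<lambda>e. F e - D e) = {}"
    using multigraph_removal[OF H eps', where ?'a = 'a] by blast
  \<comment> \<open>Each copy accounts for at most \<open>h ^ h\<close> embeddings.\<close>
  define \<delta> where "\<delta> = \<delta>' / (real ?h ^ ?h + 1)"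
  have hpos: "real ?h ^ ?h + 1 > 0" by (simp add: add_nonneg_pos)
  have delta: "\<delta> > 0" using delta' hpos by (simp add: \<delta>_def)
  have h_delta: "real ?h ^ ?h * \<delta> \<le> \<delta>'"
    using delta' hpos by (simp add: \<delta>_def field_simps)
  have "\<exists>D. (\<forall>i \<in> {1..k}. D i \<subseteq> G i) \<and>
      real (\<Sum>i \<in> {1..k}. card (D i)) \<le> \<epsilon> * real (card V) ^ 2 \<and>
      rainbow_free k H \<psi> V (\<lambda>i. G i - D i)"
    if gs: "graph_system k V G"
      and few: "real (card (rainbow_copies k H \<psi> V G)) \<le> \<delta> * real (card V) ^ ?h"
    for V :: "'a set" and G
  proof -
    let ?n = "real (card V)"
    have V: "finite V" using gs by (simp add: graph_system_def)
    have "\<exists>D. (\<forall>e\<in>?E. D e \<subseteq> G (c e) \<and> real (card (D e)) \<le> \<epsilon>' * ?n\<^sup>2) \<and>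
        embeddings H V (\<lambda>e. G (c e) - D e) = {}" if c: "c \<in> ?C" for c
    proof (rule rem[OF V])
      have "real (card (embeddings H V (\<lambda>e. G (c e)))) \<le>
          real ?h ^ ?h * real (card (rainbow_copies k H \<psi> V G))"
        using of_nat_mono[OF card_embeddings_le[OF H V c, of G], where ?'a = real] by simp
      also have "\<dots> \<le> real ?h ^ ?h * (\<delta> * ?n ^ ?h)" by (rule mult_left_mono[OF few]) simp
      also have "\<dots> \<le> \<delta>' * ?n ^ ?h"
        using mult_right_mono[OF h_delta, of "?n ^ ?h"] by (simp add: mult.assoc)
      finally show "real (card (embeddings H V (\<lambda>e. G (c e)))) \<le> \<delta>' * ?n ^ ?h" .
    qed
    then obtain D where D: "\<And>c e. c \<in> ?C \<Longrightarrow> e \<in> ?E \<Longrightarrow>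
        D c e \<subseteq> G (c e) \<and> real (card (D c e)) \<le> \<epsilon>' * ?n\<^sup>2"
      and free: "\<And>c. c \<in> ?C \<Longrightarrow> embeddings H V (\<lambda>e. G (c e) - D c e) = {}"
      by metis
    \<comment> \<open>Graph \<open>i\<close> loses whatever was deleted for an edge of color
      \<open>i\<close> under any of the colorings.\<close>
    define D' where "D' i = (\<Union>c\<in>?C. \<Union>e\<in>{e \<in> ?E. c e = i}. D c e)" for i
    have "D' i \<subseteq> G i" for i using D by (auto simp: D'_def)
    moreover have "real (\<Sum>i \<in> {1..k}. card (D' i)) \<le> \<epsilon> * ?n\<^sup>2"
    proof -
      have "card (D' i) \<le> (\<Sum>c\<in>?C. \<Sum>e\<in>{e \<in> ?E. c e = i}. card (D c e))" for i
        unfolding D'_def using C E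
        by (intro order_trans[OF card_UN_le] sum_mono card_UN_le) auto
      then have "(\<Sum>i \<in> {1..k}. card (D' i)) \<le>
          (\<Sum>i \<in> {1..k}. \<Sum>c\<in>?C. \<Sum>e\<in>{e \<in> ?E. c e = i}. card (D c e))"
        by (rule sum_mono)
      also have "\<dots> = (\<Sum>c\<in>?C. \<Sum>i \<in> {1..k}. \<Sum>e\<in>{e \<in> ?E. c e = i}. card (D c e))"
        by (rule sum.swap)
      \<comment> \<open>Under a fixed coloring each edge has exactly one color in
        \<open>{1..k}\<close>, so grouping the edges by color counts each of them once.\<close>
      also have "\<dots> = (\<Sum>c\<in>?C. \<Sum>e\<in>?E. card (D c e))"
        using E by (intro sum.cong sum.group) (auto simp: full_colorings_def)
      finally have "real (\<Sum>i \<in> {1..k}. card (D' i)) \<le> real (\<Sum>c\<in>?C. \<Sum>e\<in>?E. card (D c e))"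
        by (simp only: of_nat_le_iff)
      also have "\<dots> = (\<Sum>c\<in>?C. \<Sum>e\<in>?E. real (card (D c e)))" by simp
      also have "\<dots> \<le> (\<Sum>c\<in>?C. \<Sum>e\<in>?E. \<epsilon>' * ?n\<^sup>2)" using D by (intro sum_mono) auto
      also have "\<dots> = real N * \<epsilon>' * ?n\<^sup>2" by (simp add: N_def)
      also have "\<dots> \<le> \<epsilon> * ?n\<^sup>2" by (rule mult_right_mono[OF eps'_N]) simp
      finally show ?thesis .
    qed
    moreover have "rainbow_free k H \<psi> V (\<lambda>i. G i - D' i)"
      unfolding rainbow_free_def
    proof
      assume "\<exists>H' \<psi>'. rainbow_copy k H \<psi> V (\<lambda>i. G i - D' i) H' \<psi>'"
      then obtain c f where c: "c \<in> ?C" and f: "f \<in> embeddings H V (\<lambda>e. G (c e) - D' (c e))"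
        using embedding_of_rainbow_copy[OF H assms(3)] by blast
      \<comment> \<open>The combined deletion contains the one made for \<open>c\<close>, so
        \<open>f\<close> would also survive the latter.\<close>
      have "D c e \<subseteq> D' (c e)" if "e \<in> ?E" for e using c that by (auto simp: D'_def)
      then have "f \<in> embeddings H V (\<lambda>e. G (c e) - D c e)"
        using f by (auto simp: embeddings_def)
      then show False using free[OF c] by simp
    qed
    ultimately show ?thesis by blast
  qed
  then show ?thesis using delta by blast
qed

end
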